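(* Let $a,b,c,d$ be constants. Then in a neighborhood of $x=0$, $$\sum_{n=0}^\infty\binom{2n}{n}(an+b)\frac{x^n}{(1+4x)^{2n}}\sum_{k=0}^n\binom nk\binom{2k}k\binom{2n-2k}{n-k}x^k=\sum_{n=0}^\infty\binom{2n}{n}^3(An+B)x^{2n}$$ and $$\sum_{n=0}^\infty\binom{2n}{n}(cn+d)\frac{(-x)^n}{(1-8x)^{n}}\sum_{k=0}^n\binom nk\binom{2k}k\binom{2n-2k}{n-k}x^k=\sum_{n=0}^\infty\binom{2n}{n}^3(Cn+D)x^{2n},$$ where $$A=\frac{3a}{2}\frac{(1+4x)^2}{1-4x},\quad B=(1+4x)\Bigl(b+\frac{4ax}{1-4x}\Bigr),$$ $$C=\frac{3c}{2}\frac{(1-8x)^{3/2}}{1-16x^2},\quad D=\sqrt{1-8x}\Bigl(d-\frac{4cx(1-2x)}{1-16x^2}\Bigr).$$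
   Context: Square roots and powers $(1-8x)^{3/2}$ are the principal branches (equal to $1$ at $x=0$). *)

theory Defs imports "HOL-Analysis.Analysis" begin

end

theory Submission imports Defs "HOL-Complex_Analysis.Complex_Analysis" begin

text \<open>
  Write \<open>u\<^sub>n\<close> for the central binomial coefficient.  With \<open>X = x t\<close> and \<open>Y = t\<close>, both left-hand sides are
  values of the Appell series \<open>\<Sum> u\<^bsub>k+j\<^esub> (k+j choose k) u\<^sub>k u\<^sub>j X\<^sup>k Y\<^sup>j\<close> (and of its versions weighted by \<open>k + j\<close>)
  along the curves \<open>t = x / (1 + 4x)\<^sup>2\<close> and \<open>t = -x / (1 - 8x)\<close>.  The series weighted by \<open>k\<^sup>p j\<^sup>q\<close> for
  \<open>p, q \<le> 1\<close> span a holonomic system of rank four, which becomes on each curve a linear system of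
  differential equations in \<open>x\<close> with a regular singularity at \<open>0\<close> and nilpotent residue.  An analytic solution
  of it is therefore determined by its value at \<open>0\<close>.  Explicit combinations of \<open>S = \<Sum> u\<^sub>n\<^sup>3 x\<^bsup>2n\<^esup>\<close> and its
  first two derivatives, with algebraic coefficients, solve the same system because \<open>S\<close> satisfies a
  third-order differential equation; comparing the two solutions yields the theorem.
\<close>

section \<open>Coefficients and terms of the Appell series\<close>

text \<open>By symmetry and Pascal's rule \<open>(2n+2 choose n+1) = 2 (2n+1 choose n)\<close>, to
  which absorption applies. This recurrence is the source of all differential equations
  below.\<close>

lemma Suc_mult_central_binomial:
  "Suc n * (2 * Suc n choose Suc n) = (4 * n + 2) * (2 * n choose n)"
proof -
  have 1: "Suc n * (Suc (2 * n) choose n) = Suc (2 * n) * (2 * n choose n)"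
    using binomial_absorb_comp[of "Suc (2 * n)" n] by simp
  have "Suc (2 * n) choose Suc n = (Suc (2 * n) choose n)"
    using binomial_symmetric[of n "Suc (2 * n)"] by simp
  hence "2 * Suc n choose Suc n = 2 * (Suc (2 * n) choose n)"
    by simp
  hence "Suc n * (2 * Suc n choose Suc n) = 2 * (Suc n * (Suc (2 * n) choose n))"
    by (simp only: mult_ac)
  thus ?thesis unfolding 1 by simp
qed

lemma Suc_mult_central_binomial_of_nat:
  "(1 + of_nat n) * of_nat (2 * Suc n choose Suc n) =
    (4 * of_nat n + 2) * (of_nat (2 * n choose n) :: 'a :: comm_semiring_1)"
proof -
  have "of_nat (Suc n * (2 * Suc n choose Suc n)) =
      (of_nat ((4 * n + 2) * (2 * n choose n)) :: 'a)"
    by (simp only: Suc_mult_central_binomial)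
  thus ?thesis by (simp only: of_nat_mult of_nat_add of_nat_Suc of_nat_numeral)
qed

section \<open>Geometric bounds and termwise differentiation\<close>

lemma of_nat_power_le_eight_power:
  assumes "m \<le> 3"
  shows "real n ^ m \<le> 8 ^ n"
proof (cases "n = 0")
  case False
  \<comment> \<open>Three is the largest total weight that occurs, so one geometric bound serves all
    weights.\<close>
  have "real n ^ m \<le> real n ^ 3"
    using False assms by (intro power_increasing) auto
  also have "\<dots> \<le> (2 ^ n) ^ 3"
    by (intro power_mono) (auto intro: less_imp_le)
  also have "\<dots> = 8 ^ n"
    by (simp add: power_mult[symmetric] mult.commute[of n] power_mult)
  finally show ?thesis .
qed (auto simp: power_le_one)

lemma central_binomial_le_four_power: "real (2 * n choose n) \<le> 4 ^ n"
proof -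
  have "real (2 * n choose n) \<le> real (2 ^ (2 * n))"
    using binomial_le_pow2 by (intro of_nat_mono)
  thus ?thesis by (simp add: power_mult)
qed

text \<open>By Weierstrass, a summable majorant of the holomorphic terms themselves already controls
  the series of their derivatives.\<close>

lemma termwise_deriv:
  fixes t :: "nat \<Rightarrow> complex \<Rightarrow> complex"
  assumes "open U" "summable h"
    and "\<And>n x. x \<in> U \<Longrightarrow> (t n has_field_derivative t' n x) (at x)"
    and "\<And>n x. x \<in> U \<Longrightarrow> norm (t n x) \<le> h n"
  shows "(\<lambda>x. \<Sum>n. t n x) holomorphic_on U"
    and "x \<in> U \<Longrightarrow> (\<lambda>n. t' n x) sums deriv (\<lambda>x. \<Sum>n. t n x) x"
proof -
  have le: "\<forall>\<^sub>F n in sequentially. \<forall>x\<in>U. norm (t n x) \<le> h n"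
    using assms(4) by simp
  obtain g g' where g: "\<forall>x\<in>U. (\<lambda>n. t n x) sums g x \<and> (\<lambda>n. t' n x) sums g' x \<and>
      (g has_field_derivative g' x) (at x)"
    by (rule series_and_derivative_comparison[OF assms(1-3) le])
  have eq: "g x = (\<Sum>n. t n x)" if "x \<in> U" for x
    using g that by (blast dest: sums_unique)
  have deriv: "((\<lambda>x. \<Sum>n. t n x) has_field_derivative g' x) (at x)" if "x \<in> U" for x
    by (rule has_field_derivative_transform_within_open[of g "g' x" x U])
      (use g that eq \<open>open U\<close> in simp_all)
  show "(\<lambda>x. \<Sum>n. t n x) holomorphic_on U"
    using deriv \<open>open U\<close> by (subst holomorphic_on_open) auto
  show "(\<lambda>n. t' n x) sums deriv (\<lambda>x. \<Sum>n. t n x) x" if "x \<in> U"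
    using g that DERIV_imp_deriv[OF deriv[OF that]] by simp
qed

text \<open>
  The part of total degree \<open>n\<close> of the Appell series \<open>F\<^sub>2(1/2; 1/2, 1/2; 1, 1; 16X, 16Y)\<close>, where the monomial
  \<open>X\<^sup>k Y\<^sup>j\<close> carries the additional weight \<open>k\<^sup>p j\<^sup>q\<close>.
\<close>

definition appell_term :: "nat \<Rightarrow> nat \<Rightarrow> nat \<Rightarrow> complex \<Rightarrow> complex \<Rightarrow> complex" where
  "appell_term p q n X Y = of_nat (2 * n choose n) *
     (\<Sum>k=0..n. of_nat (n choose k) * of_nat (2 * k choose k) *
        of_nat (2 * (n - k) choose (n - k)) * of_nat k ^ p * of_nat (n - k) ^ q * X ^ k * Y ^ (n - k))"

lemma appell_term_0: "appell_term p q 0 X Y = 0 ^ p * 0 ^ q"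
  by (simp add: appell_term_def)

text \<open>Reversing the inner sum exchanges \<open>k\<close> and \<open>n - k\<close>. This later
  yields the relation for \<open>Y\<close> from the one for \<open>X\<close>.\<close>

lemma appell_term_commute: "appell_term p q n X Y = appell_term q p n Y X"
  unfolding appell_term_def
proof (rule arg_cong[where f = "\<lambda>s. _ * s"], subst sum.atLeastAtMost_rev, rule sum.cong)
  fix k assume "k \<in> {0..n}"
  hence "k \<le> n" by simp
  thus "of_nat (n choose (n + 0 - k)) * of_nat (2 * (n + 0 - k) choose (n + 0 - k)) *
        of_nat (2 * (n - (n + 0 - k)) choose (n - (n + 0 - k))) * of_nat (n + 0 - k) ^ p *
        of_nat (n - (n + 0 - k)) ^ q * X ^ (n + 0 - k) * Y ^ (n - (n + 0 - k)) =
     of_nat (n choose k) * of_nat (2 * k choose k) * of_nat (2 * (n - k) choose (n - k)) *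
        of_nat k ^ q * of_nat (n - k) ^ p * Y ^ k * X ^ (n - k)"
    using binomial_symmetric[of k n] by (simp add: mult_ac)
qed simp

text \<open>The weight \<open>k^2\<close> removes the term \<open>k = 0\<close>, so the sum can be
  shifted to \<open>k + 1\<close>. The coefficient recurrence then produces
  \<open>(4k + 2)(4n + 2)\<close>, which is expanded in \<open>k\<close> and \<open>j\<close> with
  \<open>n = k + j\<close>.\<close>

lemma appell_term_Suc:
  "appell_term 2 q (Suc n) X Y = X * (16 * appell_term 2 q n X Y + 16 * appell_term 1 (Suc q) n X Y +
     16 * appell_term 1 q n X Y + 8 * appell_term 0 (Suc q) n X Y + 4 * appell_term 0 q n X Y)"
proof -
  define u where "u = (\<lambda>n. of_nat (2 * n choose n) :: complex)"
  define j where "j k = (of_nat (n - k) :: complex)" for k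
  define w where "w k = u n * of_nat (n choose k) * u k * u (n - k) * j k ^ q * X ^ k * Y ^ (n - k)" for k
  have weights: "(\<Sum>k=0..n. of_nat k ^ p * j k ^ r * w k) = appell_term p (r + q) n X Y" for p r
    unfolding appell_term_def sum_distrib_left w_def u_def j_def
    by (simp only: power_add mult_ac)
  \<comment> \<open>One factor \<open>k + 1\<close> turns \<open>(n+1 choose k+1)\<close> into
    \<open>n + 1\<close> times \<open>(n choose k)\<close>, and this \<open>n + 1\<close> lowers
    \<open>u (Suc n)\<close>. The other factor \<open>k + 1\<close> lowers
    \<open>u (Suc k)\<close>.\<close>
  have step: "u (Suc n) * (of_nat (Suc n choose Suc k) * u (Suc k) * u (n - k) *
      of_nat (Suc k) ^ 2 * j k ^ q * X ^ Suc k * Y ^ (n - k)) =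
      X * ((4 * of_nat k + 2) * (4 * of_nat n + 2) * w k)" for k
  proof -
    have "of_nat (Suc k * (Suc n choose Suc k)) = (of_nat (Suc n * (n choose k)) :: complex)"
      by (simp only: Suc_times_binomial)
    hence 1: "(1 + of_nat k) * of_nat (Suc n choose Suc k) = (1 + of_nat n) * (of_nat (n choose k) :: complex)"
      by (simp only: of_nat_mult of_nat_Suc)
    have u: "(1 + of_nat m) * u (Suc m) = (4 * of_nat m + 2) * u m" for m
      unfolding u_def by (rule Suc_mult_central_binomial_of_nat)
    have "u (Suc n) * (of_nat (Suc n choose Suc k) * u (Suc k) * u (n - k) *
        of_nat (Suc k) ^ 2 * j k ^ q * X ^ Suc k * Y ^ (n - k)) =
      u (Suc n) * ((1 + of_nat k) * of_nat (Suc n choose Suc k)) * ((1 + of_nat k) * u (Suc k)) *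
        (X * (u (n - k) * j k ^ q * X ^ k * Y ^ (n - k)))"
      by (simp only: of_nat_Suc power2_eq_square power_Suc mult_ac)
    also have "\<dots> = ((1 + of_nat n) * u (Suc n)) * of_nat (n choose k) * ((1 + of_nat k) * u (Suc k)) *
        (X * (u (n - k) * j k ^ q * X ^ k * Y ^ (n - k)))"
      unfolding 1 by (simp only: mult_ac)
    also have "\<dots> = X * ((4 * of_nat k + 2) * (4 * of_nat n + 2) * w k)"
      unfolding u w_def by (simp only: mult_ac)
    finally show ?thesis .
  qed
  have "appell_term 2 q (Suc n) X Y = (\<Sum>k=0..n. u (Suc n) * (of_nat (Suc n choose Suc k) * u (Suc k) *
      u (n - k) * of_nat (Suc k) ^ 2 * j k ^ q * X ^ Suc k * Y ^ (n - k)))"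
    unfolding appell_term_def sum_distrib_left u_def j_def
    by (subst sum.atLeast0_atMost_Suc_shift)
      (simp del: binomial_Suc_Suc power_Suc of_nat_Suc mult_Suc_right)
  also have "\<dots> = (\<Sum>k=0..n. X * ((4 * of_nat k + 2) * (4 * of_nat n + 2) * w k))"
    by (simp only: step)
  also have "\<dots> = (\<Sum>k=0..n. X * (16 * (of_nat k ^ 2 * j k ^ 0 * w k) + 16 * (of_nat k ^ 1 * j k ^ 1 * w k) +
      16 * (of_nat k ^ 1 * j k ^ 0 * w k) + 8 * (of_nat k ^ 0 * j k ^ 1 * w k) +
      4 * (of_nat k ^ 0 * j k ^ 0 * w k)))"
    by (intro sum.cong) (auto simp: j_def of_nat_diff algebra_simps power2_eq_square)
  also have "\<dots> = X * (16 * appell_term 2 q n X Y + 16 * appell_term 1 (Suc q) n X Y +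
     16 * appell_term 1 q n X Y + 8 * appell_term 0 (Suc q) n X Y + 4 * appell_term 0 q n X Y)"
    by (simp only: sum_distrib_left[symmetric] sum.distrib weights) simp
  finally show ?thesis .
qed

text \<open>The outer central binomial contributes \<open>4^n\<close>, the two inner ones
  \<open>4^n\<close>, the weights \<open>8^n\<close>, and the binomial theorem
  \<open>(1/1024 + 1/1024)^n\<close>; the ratio is \<open>4 * 4 * 8 / 512 = 1/4\<close>.\<close>

lemma norm_appell_term_le:
  assumes "p + q \<le> 3" "norm X \<le> 1 / 1024" "norm Y \<le> 1 / 1024"
  shows "norm (appell_term p q n X Y) \<le> (1 / 4) ^ n"
proof -
  have "norm (\<Sum>k=0..n. of_nat (n choose k) * of_nat (2 * k choose k) *
        of_nat (2 * (n - k) choose (n - k)) * of_nat k ^ p * of_nat (n - k) ^ q * X ^ k * Y ^ (n - k))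
      \<le> (\<Sum>k=0..n. 32 ^ n * (real (n choose k) * (1 / 1024) ^ k * (1 / 1024) ^ (n - k)))"
  proof (rule sum_norm_le)
    fix k assume "k \<in> {0..n}"
    hence k: "k \<le> n" by simp
    have "real (2 * k choose k) * real (2 * (n - k) choose (n - k)) \<le> 4 ^ k * 4 ^ (n - k)"
      by (intro mult_mono central_binomial_le_four_power) auto
    hence 1: "real (2 * k choose k) * real (2 * (n - k) choose (n - k)) \<le> 4 ^ n"
      using k by (simp flip: power_add)
    have "real k ^ p * real (n - k) ^ q \<le> real n ^ p * real n ^ q"
      using k by (intro mult_mono power_mono) auto
    also have "\<dots> \<le> 8 ^ n"
      unfolding power_add[symmetric] using assms(1) by (rule of_nat_power_le_eight_power)
    finally have 2: "real k ^ p * real (n - k) ^ q \<le> 8 ^ n" .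
    have 3: "norm X ^ k * norm Y ^ (n - k) \<le> (1 / 1024) ^ k * (1 / 1024) ^ (n - k)"
      using assms by (intro mult_mono power_mono) auto
    have "norm (of_nat (n choose k) * of_nat (2 * k choose k) *
        of_nat (2 * (n - k) choose (n - k)) * of_nat k ^ p * of_nat (n - k) ^ q * X ^ k * Y ^ (n - k)) =
      real (n choose k) * (((real (2 * k choose k) * real (2 * (n - k) choose (n - k))) *
        (real k ^ p * real (n - k) ^ q)) * (norm X ^ k * norm Y ^ (n - k)))"
      by (simp add: norm_mult norm_power mult_ac del: of_nat_diff)
    also have "\<dots> \<le> real (n choose k) * ((4 ^ n * 8 ^ n) * ((1 / 1024) ^ k * (1 / 1024) ^ (n - k)))"
      by (intro mult_left_mono mult_mono 1 2 3) auto
    also have "\<dots> = 32 ^ n * (real (n choose k) * (1 / 1024) ^ k * (1 / 1024) ^ (n - k))"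
      by (simp add: mult_ac flip: power_mult_distrib)
    finally show "norm (of_nat (n choose k) * of_nat (2 * k choose k) *
        of_nat (2 * (n - k) choose (n - k)) * of_nat k ^ p * of_nat (n - k) ^ q * X ^ k * Y ^ (n - k))
      \<le> 32 ^ n * (real (n choose k) * (1 / 1024) ^ k * (1 / 1024) ^ (n - k))" .
  qed
  also have "\<dots> = 32 ^ n * (1 / 1024 + 1 / 1024) ^ n"
    unfolding sum_distrib_left[symmetric] by (subst binomial_ring) (simp add: atLeast0AtMost)
  also have "\<dots> = (1 / 16) ^ n"
    by (simp flip: power_mult_distrib)
  finally have "norm (appell_term p q n X Y) \<le> 4 ^ n * (1 / 16) ^ n"
    unfolding appell_term_def norm_mult norm_of_nat
    by (intro mult_mono central_binomial_le_four_power) auto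
  thus ?thesis by (simp flip: power_mult_distrib)
qed

text \<open>The Euler operator \<open>x d/dx\<close> multiplies \<open>X^k Y^j\<close> by
  \<open>\<xi> k + \<eta> j\<close>, which raises one of the two weights. The formula for
  \<open>x * D\<close> avoids a division by \<open>x\<close> at the origin.\<close>

lemma appell_term_has_derivative:
  assumes "(X has_field_derivative X') (at x)" "(Y has_field_derivative Y') (at x)"
    and "x * X' = \<xi> * X x" "x * Y' = \<eta> * Y x"
  obtains D where "((\<lambda>x. appell_term p q n (X x) (Y x)) has_field_derivative D) (at x)"
    and "x * D = \<xi> * appell_term (Suc p) q n (X x) (Y x) + \<eta> * appell_term p (Suc q) n (X x) (Y x)"
proof
  define c :: "nat \<Rightarrow> complex" where "c k = of_nat (n choose k) * of_nat (2 * k choose k) *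
      of_nat (2 * (n - k) choose (n - k)) * of_nat k ^ p * of_nat (n - k) ^ q" for k
  \<comment> \<open>For \<open>m = 0\<close> the truncated exponent \<open>m - Suc 0\<close> does no
    harm, since the factor \<open>of_nat m\<close> is zero.\<close>
  have pow: "x * (of_nat m * (Z' * Z ^ (m - Suc 0))) = \<zeta> * of_nat m * Z ^ m"
    if "x * Z' = \<zeta> * Z" for m \<zeta> Z Z'
  proof -
    have "x * (of_nat m * (Z' * Z ^ (m - Suc 0))) = of_nat m * (x * Z') * Z ^ (m - Suc 0)"
      by (simp only: mult_ac)
    also have "\<dots> = \<zeta> * of_nat m * Z ^ m"
      unfolding that by (cases m) simp_all
    finally show ?thesis .
  qed
  define d where "d k = c k * X x ^ k * (of_nat (n - k) * (Y' * Y x ^ (n - k - Suc 0)))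
     + c k * (of_nat k * (X' * X x ^ (k - Suc 0))) * Y x ^ (n - k)" for k
  let ?D = "of_nat (2 * n choose n) * (\<Sum>k=0..n. d k)"
  have "((\<lambda>x. c k * X x ^ k * Y x ^ (n - k)) has_field_derivative d k) (at x)" for k
    unfolding d_def by (intro DERIV_mult' DERIV_cmult DERIV_power assms(1,2))
  thus "((\<lambda>x. appell_term p q n (X x) (Y x)) has_field_derivative ?D) (at x)"
    unfolding appell_term_def c_def[symmetric] by (intro DERIV_cmult DERIV_sum)
  have "x * ?D = of_nat (2 * n choose n) *
     (\<Sum>k=0..n. c k * X x ^ k * (x * (of_nat (n - k) * (Y' * Y x ^ (n - k - Suc 0))))
     + c k * (x * (of_nat k * (X' * X x ^ (k - Suc 0)))) * Y x ^ (n - k))"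
    by (simp only: d_def sum_distrib_left distrib_left mult_ac)
  also have "\<dots> = \<xi> * appell_term (Suc p) q n (X x) (Y x) + \<eta> * appell_term p (Suc q) n (X x) (Y x)"
    unfolding pow[OF assms(3)] pow[OF assms(4)] appell_term_def sum_distrib_left sum.distrib[symmetric]
    by (intro sum.cong) (simp_all add: c_def distrib_left mult_ac del: of_nat_diff)
  finally show "x * ?D = \<xi> * appell_term (Suc p) q n (X x) (Y x) + \<eta> * appell_term p (Suc q) n (X x) (Y x)" .
qed

section \<open>The system of differential equations\<close>

text \<open>
  The family \<open>f p q\<close> behaves like the Appell series with weights \<open>k\<^sup>p j\<^sup>q\<close> along the curve \<open>(X x, Y x)\<close>, where
  \<open>\<xi>\<close> and \<open>\<eta>\<close> are the logarithmic derivatives \<open>x X' / X\<close> and \<open>x Y' / Y\<close>.  The last two conditions come from the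
  recurrence \<open>(k + 1)\<^sup>2 c(k+1, j) = (4k + 2) (4k + 4j + 2) c(k, j)\<close> of the coefficients and its mirror image.
\<close>

definition appell_solution ::
  "(complex \<Rightarrow> complex) \<Rightarrow> (complex \<Rightarrow> complex) \<Rightarrow> (complex \<Rightarrow> complex) \<Rightarrow> (complex \<Rightarrow> complex) \<Rightarrow>
    complex set \<Rightarrow> (nat \<Rightarrow> nat \<Rightarrow> complex \<Rightarrow> complex) \<Rightarrow> bool" where
  "appell_solution X Y \<xi> \<eta> U f \<longleftrightarrow>
     (\<forall>p\<le>2. \<forall>q\<le>2. p + q \<le> 3 \<longrightarrow> f p q holomorphic_on U) \<and>
     (\<forall>x\<in>U. \<forall>p\<le>1. \<forall>q\<le>1. x * deriv (f p q) x = \<xi> x * f (Suc p) q x + \<eta> x * f p (Suc q) x) \<and>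
     (\<forall>x\<in>U. \<forall>q\<le>1. f 2 q x = X x *
        (16 * f 2 q x + 16 * f 1 (Suc q) x + 16 * f 1 q x + 8 * f 0 (Suc q) x + 4 * f 0 q x)) \<and>
     (\<forall>x\<in>U. \<forall>p\<le>1. f p 2 x = Y x *
        (16 * f p 2 x + 16 * f (Suc p) 1 x + 16 * f p 1 x + 8 * f (Suc p) 0 x + 4 * f p 0 x))"

section \<open>Uniqueness of analytic solutions\<close>

lemma fps_mult_nth_leading:
  fixes A V :: "'a :: comm_ring_1 fps"
  assumes "\<And>i. i < m \<Longrightarrow> fps_nth V i = 0"
  shows "fps_nth (A * V) m = fps_nth A 0 * fps_nth V m"
proof -
  have "fps_nth (A * V) m = (\<Sum>i=0..m. fps_nth A i * fps_nth V (m - i))"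
    by (simp add: fps_mult_nth)
  also have "\<dots> = (\<Sum>i\<in>{0}. fps_nth A i * fps_nth V (m - i))"
    by (rule sum.mono_neutral_right) (use assms in auto)
  finally show ?thesis by simp
qed

lemma appell_fps_zero:
  fixes G :: "nat \<Rightarrow> nat \<Rightarrow> complex fps"
  assumes X0: "fps_nth X 0 = 0" and Y0: "fps_nth Y 0 = 0"
    and deriv: "\<And>p q. p \<le> 1 \<Longrightarrow> q \<le> 1 \<Longrightarrow>
      fps_X * fps_deriv (G p q) = \<xi> * G (Suc p) q + \<eta> * G p (Suc q)"
    and X: "\<And>q. q \<le> 1 \<Longrightarrow> G 2 q = X *
        (16 * G 2 q + 16 * G 1 (Suc q) + 16 * G 1 q + 8 * G 0 (Suc q) + 4 * G 0 q)"
    and Y: "\<And>p. p \<le> 1 \<Longrightarrow> G p 2 = Y *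
        (16 * G p 2 + 16 * G (Suc p) 1 + 16 * G p 1 + 8 * G (Suc p) 0 + 4 * G p 0)"
    and init: "\<And>p q. p \<le> 1 \<Longrightarrow> q \<le> 1 \<Longrightarrow> fps_nth (G p q) 0 = 0"
  shows "\<forall>p q. p \<le> 2 \<longrightarrow> q \<le> 2 \<longrightarrow> p + q \<le> 3 \<longrightarrow> fps_nth (G p q) m = 0"
\<comment> \<open>Since \<open>X\<close> and \<open>Y\<close> vanish at \<open>0\<close>, the coefficients of order \<open>m\<close> vanish first for the weights of
  degree two in one variable, and then for \<open>(1,1)\<close>, \<open>(1,0)\<close>, \<open>(0,1)\<close> and \<open>(0,0)\<close> in turn.\<close>
proof (induction m rule: less_induct)
  case (less m)
  have IH: "fps_nth (G p q) i = 0" if "i < m" "p \<le> 2" "q \<le> 2" "p + q \<le> 3" for i p q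
    using less that by blast
  have nm: "fps_nth (numeral w * H) i = numeral w * fps_nth H i" for w i and H :: "complex fps"
    by (simp add: fps_numeral_fps_const)
  have G2: "fps_nth (G 2 q) m = 0" if "q \<le> 1" for q
    using that by (subst X[OF that], subst fps_mult_nth_leading) (auto simp: X0 IH nm)
  have G2': "fps_nth (G p 2) m = 0" if "p \<le> 1" for p
    using that by (subst Y[OF that], subst fps_mult_nth_leading) (auto simp: Y0 IH nm)
  have step: "fps_nth (G p q) m = 0" if pq: "p \<le> 1" "q \<le> 1"
    and "fps_nth (G (Suc p) q) m = 0" "fps_nth (G p (Suc q)) m = 0" for p q
  \<comment> \<open>On coefficients of order \<open>m\<close>, the operator \<open>x d/dx\<close> is
    multiplication by \<open>m\<close>, which cancels for \<open>m > 0\<close>; order 0 is the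
    initial value.\<close>
  proof (cases "m = 0")
    case True
    thus ?thesis using init pq by simp
  next
    case False
    have "of_nat m * fps_nth (G p q) m = fps_nth (fps_X * fps_deriv (G p q)) m"
      using False by (cases m) auto
    also have "\<dots> = fps_nth (\<xi> * G (Suc p) q) m + fps_nth (\<eta> * G p (Suc q)) m"
      using pq by (simp add: deriv)
    also have "fps_nth (\<xi> * G (Suc p) q) m = 0"
      using pq that by (subst fps_mult_nth_leading) (auto simp: IH)
    also have "fps_nth (\<eta> * G p (Suc q)) m = 0"
      using pq that by (subst fps_mult_nth_leading) (auto simp: IH)
    finally show ?thesis using False by simp
  qed
  have G11: "fps_nth (G 1 1) m = 0"
    using G2[of 1] G2'[of 1] by - (rule step; simp add: numeral_2_eq_2)
  have G10: "fps_nth (G 1 0) m = 0"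
    using G2[of 0] G11 by - (rule step; simp add: numeral_2_eq_2)
  have G01: "fps_nth (G 0 1) m = 0"
    using G2'[of 0] G11 by - (rule step; simp add: numeral_2_eq_2)
  have G00: "fps_nth (G 0 0) m = 0"
    using G10 G01 by - (rule step; simp)
  show ?case
  proof (intro allI impI)
    fix p q :: nat assume "p \<le> 2" "q \<le> 2" "p + q \<le> 3"
    then consider "p = 2" "q \<le> 1" | "q = 2" "p \<le> 1" | "p \<in> {0, 1}" "q \<in> {0, 1}" by force
    thus "fps_nth (G p q) m = 0"
      by cases (use G2 G2' G00 G01 G10 G11 in auto)
  qed
qed

text \<open>The system is linear, so the difference \<open>d\<close> of two solutions satisfies it
  with zero initial values, and \<open>appell_fps_zero\<close> annihilates its Taylor series. At 0
  the entries with a weight 2 vanish by themselves, since \<open>X 0 = Y 0 = 0\<close>.\<close>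

lemma appell_solution_unique:
  assumes f: "appell_solution X Y \<xi> \<eta> U f" and h: "appell_solution X Y \<xi> \<eta> U h"
    and U: "open U" "0 \<in> U"
    and hol: "X holomorphic_on U" "Y holomorphic_on U" "\<xi> holomorphic_on U" "\<eta> holomorphic_on U"
    and X0: "X 0 = 0" and Y0: "Y 0 = 0"
    and init: "\<And>p q. p \<le> 1 \<Longrightarrow> q \<le> 1 \<Longrightarrow> f p q 0 = h p q 0"
    and pq: "p \<le> 1" "q \<le> 1"
  shows "\<forall>\<^sub>F x in nhds 0. f p q x = h p q x"
proof -
  define d where "d p q = (\<lambda>x. f p q x - h p q x)" for p q
  have fps: "F has_fps_expansion fps_expansion F 0" if "F holomorphic_on U" for F
    using that U by blast
  define G where "G p q = fps_expansion (d p q) 0" for p q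
  have G: "d p q has_fps_expansion G p q" if "p \<le> 2" "q \<le> 2" "p + q \<le> 3" for p q
    using f h that unfolding G_def d_def appell_solution_def by (intro fps holomorphic_on_diff) auto
  \<comment> \<open>Transfers each relation of the system from functions on \<open>U\<close> to
    power series.\<close>
  have unique: "F = H" if "u has_fps_expansion F" "v has_fps_expansion H" "\<And>x. x \<in> U \<Longrightarrow> u x = v x"
    for u v :: "complex \<Rightarrow> complex" and F H
  proof (rule fps_expansion_unique_complex[OF that(1)])
    have "eventually (\<lambda>x. u x = v x) (nhds 0)"
      using eventually_nhds_in_open[OF U] by eventually_elim (use that(3) in auto)
    thus "u has_fps_expansion H"
      using that(2) has_fps_expansion_cong by blast
  qed
  have "fps_nth (G p q) m = 0" for m
  proof -
    have "\<forall>p q. p \<le> 2 \<longrightarrow> q \<le> 2 \<longrightarrow> p + q \<le> 3 \<longrightarrow> fps_nth (G p q) m = 0"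
    proof (rule appell_fps_zero)
      show "fps_nth (fps_expansion X 0) 0 = 0" "fps_nth (fps_expansion Y 0) 0 = 0"
        using X0 Y0 by (simp_all add: fps_expansion_def)
      show "fps_nth (G p q) 0 = 0" if "p \<le> 1" "q \<le> 1" for p q
        using init[OF that] by (simp add: fps_expansion_def G_def d_def)
      show "fps_X * fps_deriv (G p q) =
          fps_expansion \<xi> 0 * G (Suc p) q + fps_expansion \<eta> 0 * G p (Suc q)" if "p \<le> 1" "q \<le> 1" for p q
      proof (rule unique)
        show "(\<lambda>x. x * deriv (d p q) x) has_fps_expansion fps_X * fps_deriv (G p q)"
          using that by (intro fps_expansion_intros G) auto
        show "(\<lambda>x. \<xi> x * d (Suc p) q x + \<eta> x * d p (Suc q) x) has_fps_expansion
            fps_expansion \<xi> 0 * G (Suc p) q + fps_expansion \<eta> 0 * G p (Suc q)"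
          using that by (intro fps_expansion_intros G fps hol) auto
        fix x assume x: "x \<in> U"
        have "f p q holomorphic_on U" "h p q holomorphic_on U"
          using f h that unfolding appell_solution_def by auto
        hence "deriv (d p q) x = deriv (f p q) x - deriv (h p q) x"
          unfolding d_def using x U by (intro deriv_diff) (auto simp: holomorphic_on_imp_differentiable_at)
        hence "x * deriv (d p q) x = x * deriv (f p q) x - x * deriv (h p q) x"
          by (simp add: right_diff_distrib)
        thus "x * deriv (d p q) x = \<xi> x * d (Suc p) q x + \<eta> x * d p (Suc q) x"
          using f h that x unfolding appell_solution_def d_def by (simp add: algebra_simps)
      qed
      show "G 2 q = fps_expansion X 0 *
          (16 * G 2 q + 16 * G 1 (Suc q) + 16 * G 1 q + 8 * G 0 (Suc q) + 4 * G 0 q)" if "q \<le> 1" for q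
      proof (rule unique)
        show "d 2 q has_fps_expansion G 2 q"
          using that by (intro G) auto
        show "(\<lambda>x. X x * (16 * d 2 q x + 16 * d 1 (Suc q) x + 16 * d 1 q x + 8 * d 0 (Suc q) x + 4 * d 0 q x))
           has_fps_expansion fps_expansion X 0 *
          (16 * G 2 q + 16 * G 1 (Suc q) + 16 * G 1 q + 8 * G 0 (Suc q) + 4 * G 0 q)"
          using that by (intro fps_expansion_intros G fps hol) auto
        fix x assume x: "x \<in> U"
        have "d 2 q x = X x * (16 * f 2 q x + 16 * f 1 (Suc q) x + 16 * f 1 q x + 8 * f 0 (Suc q) x + 4 * f 0 q x)
          - X x * (16 * h 2 q x + 16 * h 1 (Suc q) x + 16 * h 1 q x + 8 * h 0 (Suc q) x + 4 * h 0 q x)"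
          using f h that x unfolding appell_solution_def d_def by metis
        thus "d 2 q x = X x * (16 * d 2 q x + 16 * d 1 (Suc q) x + 16 * d 1 q x + 8 * d 0 (Suc q) x + 4 * d 0 q x)"
          unfolding d_def by (simp add: algebra_simps)
      qed
      show "G p 2 = fps_expansion Y 0 *
          (16 * G p 2 + 16 * G (Suc p) 1 + 16 * G p 1 + 8 * G (Suc p) 0 + 4 * G p 0)" if "p \<le> 1" for p
      proof (rule unique)
        show "d p 2 has_fps_expansion G p 2"
          using that by (intro G) auto
        show "(\<lambda>x. Y x * (16 * d p 2 x + 16 * d (Suc p) 1 x + 16 * d p 1 x + 8 * d (Suc p) 0 x + 4 * d p 0 x))
           has_fps_expansion fps_expansion Y 0 *
          (16 * G p 2 + 16 * G (Suc p) 1 + 16 * G p 1 + 8 * G (Suc p) 0 + 4 * G p 0)"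
          using that by (intro fps_expansion_intros G fps hol) auto
        fix x assume x: "x \<in> U"
        have "d p 2 x = Y x * (16 * f p 2 x + 16 * f (Suc p) 1 x + 16 * f p 1 x + 8 * f (Suc p) 0 x + 4 * f p 0 x)
          - Y x * (16 * h p 2 x + 16 * h (Suc p) 1 x + 16 * h p 1 x + 8 * h (Suc p) 0 x + 4 * h p 0 x)"
          using f h that x unfolding appell_solution_def d_def by metis
        thus "d p 2 x = Y x * (16 * d p 2 x + 16 * d (Suc p) 1 x + 16 * d p 1 x + 8 * d (Suc p) 0 x + 4 * d p 0 x)"
          unfolding d_def by (simp add: algebra_simps)
      qed
    qed
    thus ?thesis using pq by auto
  qed
  hence "G p q = 0"
    by (simp add: fps_eq_iff)
  hence "d p q has_fps_expansion 0"
    using G[of p q] pq by simp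
  thus ?thesis
    unfolding has_fps_expansion_0_iff d_def by simp
qed

section \<open>The Appell series solves the system\<close>

definition appell_series :: "(complex \<Rightarrow> complex) \<Rightarrow> (complex \<Rightarrow> complex) \<Rightarrow> nat \<Rightarrow> nat \<Rightarrow> complex \<Rightarrow> complex"
  where "appell_series X Y p q x = (\<Sum>n. appell_term p q n (X x) (Y x))"

lemma summable_appell_term:
  assumes "p + q \<le> 3" "norm X \<le> 1 / 1024" "norm Y \<le> 1 / 1024"
  shows "summable (\<lambda>n. appell_term p q n X Y)"
  by (rule summable_comparison_test'[of "\<lambda>n. (1 / 4) ^ n" 0])
    (use norm_appell_term_le[OF assms] in auto)

text \<open>Sums \<open>appell_term_Suc\<close> over \<open>n\<close>. The shift loses nothing,
  because the term of degree 0 carries the factor \<open>0 ^ 2\<close>; \<open>q \<le> 1\<close>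
  keeps all total weights at most 3.\<close>

lemma suminf_appell_term_shift:
  assumes "q \<le> 1" "norm X \<le> 1 / 1024" "norm Y \<le> 1 / 1024"
  defines "F \<equiv> \<lambda>p q. \<Sum>n. appell_term p q n X Y"
  shows "F 2 q = X * (16 * F 2 q + 16 * F 1 (Suc q) + 16 * F 1 q + 8 * F 0 (Suc q) + 4 * F 0 q)"
proof -
  have sums: "(\<lambda>n. appell_term p q n X Y) sums F p q" if "p + q \<le> 3" for p q
    unfolding F_def using summable_appell_term[OF that assms(2,3)] by (rule summable_sums)
  have "(\<lambda>n. X * (16 * appell_term 2 q n X Y + 16 * appell_term 1 (Suc q) n X Y +
       16 * appell_term 1 q n X Y + 8 * appell_term 0 (Suc q) n X Y + 4 * appell_term 0 q n X Y))
     sums (X * (16 * F 2 q + 16 * F 1 (Suc q) + 16 * F 1 q + 8 * F 0 (Suc q) + 4 * F 0 q))"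
    using assms(1) by (intro sums_mult sums_add sums) auto
  hence "(\<lambda>n. appell_term 2 q (Suc n) X Y) sums
      (X * (16 * F 2 q + 16 * F 1 (Suc q) + 16 * F 1 q + 8 * F 0 (Suc q) + 4 * F 0 q))"
    by (simp only: appell_term_Suc)
  hence "(\<lambda>n. appell_term 2 q n X Y) sums
      (X * (16 * F 2 q + 16 * F 1 (Suc q) + 16 * F 1 q + 8 * F 0 (Suc q) + 4 * F 0 q))"
    by (subst (asm) sums_Suc_iff) (simp add: appell_term_0)
  thus ?thesis
    using sums[of 2 q] assms(1) sums_unique2 by auto
qed

text \<open>The derivative relation holds for each term and is summed with the help of the geometric
  bound. The relation for \<open>Y\<close> is the one for \<open>X\<close> with the variables
  exchanged.\<close>

lemma appell_series_solution:
  assumes U: "open U"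
    and X: "\<And>x. x \<in> U \<Longrightarrow> (X has_field_derivative X' x) (at x)"
      "\<And>x. x \<in> U \<Longrightarrow> x * X' x = \<xi> x * X x" "\<And>x. x \<in> U \<Longrightarrow> norm (X x) \<le> 1 / 1024"
    and Y: "\<And>x. x \<in> U \<Longrightarrow> (Y has_field_derivative Y' x) (at x)"
      "\<And>x. x \<in> U \<Longrightarrow> x * Y' x = \<eta> x * Y x" "\<And>x. x \<in> U \<Longrightarrow> norm (Y x) \<le> 1 / 1024"
  shows "appell_solution X Y \<xi> \<eta> U (appell_series X Y)"
proof -
  define D where "D p q n = deriv (\<lambda>x. appell_term p q n (X x) (Y x))" for p q n
  have D: "((\<lambda>x. appell_term p q n (X x) (Y x)) has_field_derivative D p q n x) (at x)"
      "x * D p q n x =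
        \<xi> x * appell_term (Suc p) q n (X x) (Y x) + \<eta> x * appell_term p (Suc q) n (X x) (Y x)"
    if x: "x \<in> U" for p q n x
    by (rule appell_term_has_derivative[OF X(1)[OF x] Y(1)[OF x] X(2)[OF x] Y(2)[OF x], of p q n],
        simp add: D_def DERIV_imp_deriv)+
  have geo: "summable (\<lambda>n. (1 / 4 :: real) ^ n)" by simp
  note td = termwise_deriv[where t = "\<lambda>n x. appell_term p q n (X x) (Y x)" and t' = "D p q" for p q,
      OF U geo D(1) norm_appell_term_le, folded appell_series_def]
  have sums: "(\<lambda>n. appell_term p q n (X x) (Y x)) sums appell_series X Y p q x"
    if "p + q \<le> 3" "x \<in> U" for p q x
    unfolding appell_series_def using that X Y by (intro summable_sums summable_appell_term)
  show ?thesis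
    unfolding appell_solution_def
  proof (intro conjI allI impI ballI)
    show "appell_series X Y p q holomorphic_on U" if "p + q \<le> 3" for p q
      using td(1)[of p q] that X(3) Y(3) by simp
  next
    fix x p q assume x: "x \<in> U" and pq: "p \<le> (1::nat)" "q \<le> (1::nat)"
    have "(\<lambda>n. D p q n x) sums deriv (appell_series X Y p q) x"
      using td(2)[of p q x] x pq X(3) Y(3) by simp
    hence 1: "(\<lambda>n. x * D p q n x) sums (x * deriv (appell_series X Y p q) x)"
      by (rule sums_mult)
    have "(\<lambda>n. x * D p q n x) sums
        (\<xi> x * appell_series X Y (Suc p) q x + \<eta> x * appell_series X Y p (Suc q) x)"
      unfolding D(2)[OF x] using pq x by (intro sums_add sums_mult sums) auto
    with 1 show "x * deriv (appell_series X Y p q) x =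
        \<xi> x * appell_series X Y (Suc p) q x + \<eta> x * appell_series X Y p (Suc q) x"
      by (rule sums_unique2)
  next
    fix x q assume "x \<in> U" "q \<le> (1::nat)"
    thus "appell_series X Y 2 q x = X x * (16 * appell_series X Y 2 q x + 16 * appell_series X Y 1 (Suc q) x +
        16 * appell_series X Y 1 q x + 8 * appell_series X Y 0 (Suc q) x + 4 * appell_series X Y 0 q x)"
      unfolding appell_series_def using X(3) Y(3) by (intro suminf_appell_term_shift)
  next
    fix x p assume "x \<in> U" "p \<le> (1::nat)"
    thus "appell_series X Y p 2 x = Y x * (16 * appell_series X Y p 2 x + 16 * appell_series X Y (Suc p) 1 x +
        16 * appell_series X Y p 1 x + 8 * appell_series X Y (Suc p) 0 x + 4 * appell_series X Y p 0 x)"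
      unfolding appell_series_def appell_term_commute[of _ _ _ "X x" "Y x"]
      using X(3) Y(3) by (intro suminf_appell_term_shift)
  qed
qed

lemma appell_series_0:
  assumes "X 0 = 0" "Y 0 = 0"
  shows "appell_series X Y p q 0 = 0 ^ p * 0 ^ q"
proof -
  have "appell_term p q n 0 0 = (if n = 0 then 0 ^ p * 0 ^ q else 0)" for n
    unfolding appell_term_def by (auto intro!: sum.neutral)
  thus ?thesis
    unfolding appell_series_def assms by (subst suminf_finite[of "{0}"]) auto
qed

section \<open>Series of cubes of central binomial coefficients\<close>

text \<open>For \<open>i = 0\<close> this is the hypergeometric series
  \<open>3F2(1/2, 1/2, 1/2; 1, 1; 64 x^2)\<close>. Raising \<open>i\<close> by one amounts to
  applying half the Euler operator \<open>x d/dx\<close>.\<close>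

definition cubic_series :: "nat \<Rightarrow> complex \<Rightarrow> complex" where
  "cubic_series i x = (\<Sum>n. of_nat n ^ i * of_nat (2 * n choose n) ^ 3 * x ^ (2 * n))"

text \<open>Weight, cubed binomial and power of \<open>x\<close> together give the ratio
  \<open>8 * 4^3 / 64^2 = 1/8\<close>.\<close>

lemma norm_cubic_term_le:
  assumes "i \<le> 3" "norm x \<le> 1 / 64"
  shows "norm (of_nat n ^ i * of_nat (2 * n choose n) ^ 3 * x ^ (2 * n) :: complex) \<le> (1 / 8) ^ n"
proof -
  have "norm (of_nat n ^ i * of_nat (2 * n choose n) ^ 3 * x ^ (2 * n) :: complex) =
      real n ^ i * real (2 * n choose n) ^ 3 * norm x ^ (2 * n)"
    by (simp add: norm_mult norm_power)
  also have "\<dots> \<le> 8 ^ n * (4 ^ n) ^ 3 * (1 / 64) ^ (2 * n)"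
    using assms
    by (intro mult_mono power_mono central_binomial_le_four_power of_nat_power_le_eight_power) auto
  also have "\<dots> = (8 * 4 ^ 3 * (1 / 64) ^ 2) ^ n"
    by (simp only: power_mult_distrib power_mult[symmetric] mult.commute[of _ n])
  also have "8 * 4 ^ 3 * (1 / 64) ^ 2 = (1 / 8 :: real)"
    by (simp add: power2_eq_square)
  finally show ?thesis .
qed

lemma cubic_series_sums:
  assumes "i \<le> 3" "norm x < 1 / 64"
  shows "(\<lambda>n. of_nat n ^ i * of_nat (2 * n choose n) ^ 3 * x ^ (2 * n)) sums cubic_series i x"
  unfolding cubic_series_def
  by (rule summable_sums, rule summable_comparison_test'[of "\<lambda>n. (1 / 8) ^ n" 0])
    (use norm_cubic_term_le assms in auto)

lemma cubic_series_deriv: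
  assumes "i \<le> 3"
  shows "cubic_series i holomorphic_on ball 0 (1 / 64)"
    and "norm x < 1 / 64 \<Longrightarrow> i \<le> 2 \<Longrightarrow> x * deriv (cubic_series i) x = 2 * cubic_series (Suc i) x"
proof -
  define c :: "nat \<Rightarrow> complex" where "c n = of_nat n ^ i * of_nat (2 * n choose n) ^ 3" for n
  have D: "((\<lambda>x. c n * x ^ (2 * n)) has_field_derivative c n * (of_nat (2 * n) * x ^ (2 * n - 1))) (at x)" for n x
    by (auto intro!: derivative_eq_intros)
  have geo: "summable (\<lambda>n. (1 / 8 :: real) ^ n)" by simp
  have eq: "cubic_series i = (\<lambda>x. \<Sum>n. c n * x ^ (2 * n))"
    by (simp add: cubic_series_def c_def fun_eq_iff)
  have le: "norm (c n * x ^ (2 * n)) \<le> (1 / 8) ^ n" if "x \<in> ball 0 (1 / 64)" for n x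
    unfolding c_def using that assms by (intro norm_cubic_term_le) auto
  show "cubic_series i holomorphic_on ball 0 (1 / 64)"
    unfolding eq by (rule termwise_deriv(1)[OF open_ball[of 0 "1 / 64"] geo D le])
  assume x: "norm x < 1 / 64" "i \<le> 2"
  have "(\<lambda>n. c n * (of_nat (2 * n) * x ^ (2 * n - 1))) sums deriv (cubic_series i) x"
    unfolding eq by (rule termwise_deriv(2)[OF open_ball[of 0 "1 / 64"] geo D le]) (use x in auto)
  hence "(\<lambda>n. x * (c n * (of_nat (2 * n) * x ^ (2 * n - 1)))) sums (x * deriv (cubic_series i) x)"
    by (rule sums_mult)
  \<comment> \<open>Multiplication by \<open>x\<close> restores the exponent \<open>2 * n\<close>;
    for \<open>n = 0\<close> both sides vanish despite the truncated exponent.\<close>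
  also have "(\<lambda>n. x * (c n * (of_nat (2 * n) * x ^ (2 * n - 1)))) =
      (\<lambda>n. 2 * (of_nat n ^ Suc i * of_nat (2 * n choose n) ^ 3 * x ^ (2 * n)))"
  proof
    fix n show "x * (c n * (of_nat (2 * n) * x ^ (2 * n - 1))) =
        2 * (of_nat n ^ Suc i * of_nat (2 * n choose n) ^ 3 * x ^ (2 * n))"
      by (cases n) (simp_all add: c_def mult_ac)
  qed
  finally show "x * deriv (cubic_series i) x = 2 * cubic_series (Suc i) x"
    using sums_mult[OF cubic_series_sums[of "Suc i" x], of 2] x sums_unique2 by fastforce
qed

text \<open>Cubing the central binomial recurrence gives
  \<open>(n+1)^3 u(n+1)^3 = (4n+2)^3 u(n)^3\<close>. Expanding and summing yields the third-order
  hypergeometric equation.\<close>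

lemma cubic_series_ode:
  assumes "norm x < 1 / 64"
  shows "(1 - 64 * x ^ 2) * cubic_series 3 x =
    x ^ 2 * (96 * cubic_series 2 x + 48 * cubic_series 1 x + 8 * cubic_series 0 x)"
proof -
  define t where "t i n = (of_nat n ^ i * of_nat (2 * n choose n) ^ 3 * x ^ (2 * n) :: complex)" for i n
  have sums: "t i sums cubic_series i x" if "i \<le> 3" for i
    unfolding t_def using cubic_series_sums[OF that assms] .
  have "t 3 (Suc n) = x ^ 2 * (64 * t 3 n + 96 * t 2 n + 48 * t 1 n + 8 * t 0 n)" for n
  proof -
    have "t 3 (Suc n) = ((1 + of_nat n) * of_nat (2 * Suc n choose Suc n)) ^ 3 * x ^ (2 * n) * x ^ 2"
      by (simp only: t_def of_nat_Suc power_mult_distrib) (simp add: power2_eq_square mult_ac)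
    also have "\<dots> = (4 * of_nat n + 2) ^ 3 * (of_nat (2 * n choose n)) ^ 3 * x ^ (2 * n) * x ^ 2"
      by (simp only: Suc_mult_central_binomial_of_nat power_mult_distrib)
    also have "\<dots> = x ^ 2 * (64 * t 3 n + 96 * t 2 n + 48 * t 1 n + 8 * t 0 n)"
      unfolding t_def by algebra
    finally show ?thesis .
  qed
  moreover have "(\<lambda>n. x ^ 2 * (64 * t 3 n + 96 * t 2 n + 48 * t 1 n + 8 * t 0 n)) sums
     (x ^ 2 * (64 * cubic_series 3 x + 96 * cubic_series 2 x + 48 * cubic_series 1 x + 8 * cubic_series 0 x))"
    by (intro sums_add sums_mult sums) auto
  ultimately have "(\<lambda>n. t 3 (Suc n)) sums
     (x ^ 2 * (64 * cubic_series 3 x + 96 * cubic_series 2 x + 48 * cubic_series 1 x + 8 * cubic_series 0 x))"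
    by simp
  hence "t 3 sums
     (x ^ 2 * (64 * cubic_series 3 x + 96 * cubic_series 2 x + 48 * cubic_series 1 x + 8 * cubic_series 0 x))"
    by (subst (asm) sums_Suc_iff) (simp add: t_def)
  from sums_unique2[OF sums this] show ?thesis
    by (simp add: algebra_simps)
qed

lemma cubic_series_at_0: "cubic_series i 0 = 0 ^ i"
proof -
  have "of_nat n ^ i * of_nat (2 * n choose n) ^ 3 * 0 ^ (2 * n) = (if n = 0 then 0 ^ i else 0 :: complex)" for n
    by auto
  thus ?thesis
    unfolding cubic_series_def by (subst suminf_finite[of "{0}"]) auto
qed

section \<open>Combinations of the cubic series as solutions of the system\<close>

definition cubic_comb ::
  "(complex \<Rightarrow> complex) \<Rightarrow> (nat \<Rightarrow> complex \<Rightarrow> complex) \<Rightarrow> complex \<Rightarrow> complex" where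
  "cubic_comb g r x = g x * (r 0 x * cubic_series 0 x + r 1 x * cubic_series 1 x + r 2 x * cubic_series 2 x)"

text \<open>
  The hypotheses compare the coefficients of \<open>cubic_series 0\<close>, \<open>1\<close> and \<open>2\<close>; the terms with \<open>r 2 x\<close> outside the
  brackets arise from eliminating \<open>cubic_series 3\<close> by means of \<open>cubic_series_ode\<close>.
\<close>

lemma cubic_comb_deriv:
  fixes s :: "nat \<Rightarrow> complex"
  assumes x: "norm x < 1 / 64"
    and g: "(g has_field_derivative g') (at x)" "x * g' = \<gamma> * g x"
    and r: "\<And>i. i \<le> 2 \<Longrightarrow> (r i has_field_derivative d i) (at x)"
    and eq0: "(1 - 64 * x ^ 2) * (\<gamma> * r 0 x + x * d 0) + 16 * x ^ 2 * r 2 x =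
      (1 - 64 * x ^ 2) * s 0"
    and eq1: "(1 - 64 * x ^ 2) * (\<gamma> * r 1 x + x * d 1 + 2 * r 0 x) + 96 * x ^ 2 * r 2 x =
      (1 - 64 * x ^ 2) * s 1"
    and eq2: "(1 - 64 * x ^ 2) * (\<gamma> * r 2 x + x * d 2 + 2 * r 1 x) + 192 * x ^ 2 * r 2 x =
      (1 - 64 * x ^ 2) * s 2"
  shows "x * deriv (cubic_comb g r) x =
    g x * (s 0 * cubic_series 0 x + s 1 * cubic_series 1 x + s 2 * cubic_series 2 x)"
proof -
  define C where "C i = cubic_series i x" for i
  define C' where "C' i = deriv (cubic_series i) x" for i
  have C: "(cubic_series i has_field_derivative C' i) (at x)" if "i \<le> 2" for i
    unfolding C'_def using cubic_series_deriv(1)[of i] that x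
    by (intro holomorphic_derivI[of _ "ball 0 (1 / 64)"]) auto
  have xC: "x * C' 0 = 2 * C 1" "x * C' 1 = 2 * C 2" "x * C' 2 = 2 * C 3"
    using cubic_series_deriv(2)[of 0 x] cubic_series_deriv(2)[of 1 x] cubic_series_deriv(2)[of 2 x] x
    by (simp_all add: C_def C'_def numeral_2_eq_2 numeral_3_eq_3)
  have ode: "(1 - 64 * x ^ 2) * C 3 = x ^ 2 * (96 * C 2 + 48 * C 1 + 8 * C 0)"
    unfolding C_def by (rule cubic_series_ode[OF x])
  \<comment> \<open>The leading coefficient of the third-order equation vanishes only at 1/8 and
    -1/8, outside the disc, so it can be cancelled at the end.\<close>
  have "norm (64 * x ^ 2) < 1"
  proof -
    have "norm x ^ 2 \<le> (1 / 64) ^ 2"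
      using x by (intro power_mono) auto
    thus ?thesis by (simp add: norm_mult norm_power power2_eq_square)
  qed
  hence nz: "1 - 64 * x ^ 2 \<noteq> 0"
    by (metis eq_iff_diff_eq_0 norm_one order_less_irrefl)
  have "deriv (cubic_comb g r) x =
      g x * ((r 0 x * C' 0 + d 0 * C 0) + (r 1 x * C' 1 + d 1 * C 1) + (r 2 x * C' 2 + d 2 * C 2)) +
      g' * (r 0 x * C 0 + r 1 x * C 1 + r 2 x * C 2)"
    unfolding cubic_comb_def [abs_def] C_def
    by (intro DERIV_imp_deriv DERIV_mult' DERIV_add g(1) r C) auto
  hence "(1 - 64 * x ^ 2) * (x * deriv (cubic_comb g r) x) = (1 - 64 * x ^ 2) * (g x * (s 0 * C 0 + s 1 * C 1 + s 2 * C 2))"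
    using xC ode eq0 eq1 eq2 g(2) by algebra
  thus ?thesis
    using nz unfolding C_def by simp
qed

text \<open>The prefactor \<open>g\<close> enters the equations only through
  \<open>\<gamma> = x g' / g\<close>, so the system reduces to identities between the coefficient
  functions. The pairs in \<open>hol\<close> are those with \<open>p, q \<le> 2\<close> and
  \<open>p + q \<le> 3\<close>; explicit finite sets let each condition unfold into concrete
  identities.\<close>

lemma cubic_comb_solution:
  assumes U: "open U" "U \<subseteq> ball 0 (1 / 64)"
    and g: "\<And>x. x \<in> U \<Longrightarrow> (g has_field_derivative g' x) (at x)"
      "\<And>x. x \<in> U \<Longrightarrow> x * g' x = \<gamma> x * g x"
    and hol: "\<forall>(p, q)\<in>{(0, 0), (0, 1), (0, 2), (1, 0), (1, 1), (1, 2), (2, 0), (2, 1)}.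
      \<forall>i\<in>{0, 1, 2}. R p q i holomorphic_on U"
    and D: "\<And>x. x \<in> U \<Longrightarrow> \<forall>p\<in>{0, 1}. \<forall>q\<in>{0, 1}. \<forall>i\<in>{0, 1, 2}.
      (R p q i has_field_derivative D p q i x) (at x)"
    and eq0: "\<And>x. x \<in> U \<Longrightarrow> \<forall>p\<in>{0, 1}. \<forall>q\<in>{0, 1}.
      (1 - 64 * x ^ 2) * (\<gamma> x * R p q 0 x + x * D p q 0 x) + 16 * x ^ 2 * R p q 2 x =
      (1 - 64 * x ^ 2) * (\<xi> x * R (Suc p) q 0 x + \<eta> x * R p (Suc q) 0 x)"
    and eq1: "\<And>x. x \<in> U \<Longrightarrow> \<forall>p\<in>{0, 1}. \<forall>q\<in>{0, 1}.
      (1 - 64 * x ^ 2) * (\<gamma> x * R p q 1 x + x * D p q 1 x + 2 * R p q 0 x) + 96 * x ^ 2 * R p q 2 x =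
      (1 - 64 * x ^ 2) * (\<xi> x * R (Suc p) q 1 x + \<eta> x * R p (Suc q) 1 x)"
    and eq2: "\<And>x. x \<in> U \<Longrightarrow> \<forall>p\<in>{0, 1}. \<forall>q\<in>{0, 1}.
      (1 - 64 * x ^ 2) * (\<gamma> x * R p q 2 x + x * D p q 2 x + 2 * R p q 1 x) + 192 * x ^ 2 * R p q 2 x =
      (1 - 64 * x ^ 2) * (\<xi> x * R (Suc p) q 2 x + \<eta> x * R p (Suc q) 2 x)"
    and X: "\<And>x. x \<in> U \<Longrightarrow> \<forall>q\<in>{0, 1}. \<forall>i\<in>{0, 1, 2}. R 2 q i x = X x *
        (16 * R 2 q i x + 16 * R 1 (Suc q) i x + 16 * R 1 q i x + 8 * R 0 (Suc q) i x + 4 * R 0 q i x)"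
    and Y: "\<And>x. x \<in> U \<Longrightarrow> \<forall>p\<in>{0, 1}. \<forall>i\<in>{0, 1, 2}. R p 2 i x = Y x *
        (16 * R p 2 i x + 16 * R (Suc p) 1 i x + 16 * R p 1 i x + 8 * R (Suc p) 0 i x + 4 * R p 0 i x)"
  shows "appell_solution X Y \<xi> \<eta> U (\<lambda>p q. cubic_comb g (R p q))"
  unfolding appell_solution_def
proof (intro conjI allI impI ballI)
  fix p q :: nat assume "p \<le> 2" "q \<le> 2" "p + q \<le> 3"
  hence "(p, q) \<in> {(0, 0), (0, 1), (0, 2), (1, 0), (1, 1), (1, 2), (2, 0), (2, 1)}"
    by (cases p; cases "p - 1"; cases q; cases "q - 1") auto
  hence R: "R p q i holomorphic_on U" if "i \<in> {0, 1, 2}" for i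
    using hol that by blast
  have "g holomorphic_on U"
    using g(1) U(1) by (subst holomorphic_on_open) auto
  moreover have "cubic_series i holomorphic_on U" if "i \<le> 2" for i
    using cubic_series_deriv(1)[of i] that U(2) by (auto intro: holomorphic_on_subset)
  ultimately show "cubic_comb g (R p q) holomorphic_on U"
    unfolding cubic_comb_def [abs_def] using R by (intro holomorphic_intros) auto
next
  fix x p q assume "p \<le> (1::nat)" "q \<le> (1::nat)" and x: "x \<in> U"
  hence p: "p \<in> {0, 1}" and q: "q \<in> {0, 1}" by auto
  have "norm x < 1 / 64" using x U(2) by auto
  moreover have "(R p q i has_field_derivative D p q i x) (at x)" if "i \<le> 2" for i
    using D[OF x] p q that by fastforce
  ultimately show "x * deriv (cubic_comb g (R p q)) x =
      \<xi> x * cubic_comb g (R (Suc p) q) x + \<eta> x * cubic_comb g (R p (Suc q)) x"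
    using cubic_comb_deriv[where r = "R p q" and d = "\<lambda>i. D p q i x" and
        s = "\<lambda>i. \<xi> x * R (Suc p) q i x + \<eta> x * R p (Suc q) i x", OF _ g(1)[OF x] g(2)[OF x] _ eq0[OF x, rule_format, OF p q]
        eq1[OF x, rule_format, OF p q] eq2[OF x, rule_format, OF p q]]
    unfolding cubic_comb_def by (simp add: algebra_simps)
next
  fix x q assume "q \<le> (1::nat)" and x: "x \<in> U"
  hence q: "q \<in> {0, 1}" by auto
  note X' = X[OF x, rule_format, OF q]
  from X'[of 0] X'[of 1] X'[of 2]
  have "R 2 q 0 x = X x * (16 * R 2 q 0 x + 16 * R 1 (Suc q) 0 x + 16 * R 1 q 0 x + 8 * R 0 (Suc q) 0 x + 4 * R 0 q 0 x)"
    "R 2 q 1 x = X x * (16 * R 2 q 1 x + 16 * R 1 (Suc q) 1 x + 16 * R 1 q 1 x + 8 * R 0 (Suc q) 1 x + 4 * R 0 q 1 x)"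
    "R 2 q 2 x = X x * (16 * R 2 q 2 x + 16 * R 1 (Suc q) 2 x + 16 * R 1 q 2 x + 8 * R 0 (Suc q) 2 x + 4 * R 0 q 2 x)"
    by blast+
  thus "cubic_comb g (R 2 q) x = X x * (16 * cubic_comb g (R 2 q) x + 16 * cubic_comb g (R 1 (Suc q)) x +
      16 * cubic_comb g (R 1 q) x + 8 * cubic_comb g (R 0 (Suc q)) x + 4 * cubic_comb g (R 0 q) x)"
    unfolding cubic_comb_def by algebra
next
  fix x p assume "p \<le> (1::nat)" and x: "x \<in> U"
  hence p: "p \<in> {0, 1}" by auto
  note Y' = Y[OF x, rule_format, OF p]
  from Y'[of 0] Y'[of 1] Y'[of 2]
  have "R p 2 0 x = Y x * (16 * R p 2 0 x + 16 * R (Suc p) 1 0 x + 16 * R p 1 0 x + 8 * R (Suc p) 0 0 x + 4 * R p 0 0 x)"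
    "R p 2 1 x = Y x * (16 * R p 2 1 x + 16 * R (Suc p) 1 1 x + 16 * R p 1 1 x + 8 * R (Suc p) 0 1 x + 4 * R p 0 1 x)"
    "R p 2 2 x = Y x * (16 * R p 2 2 x + 16 * R (Suc p) 1 2 x + 16 * R p 1 2 x + 8 * R (Suc p) 0 2 x + 4 * R p 0 2 x)"
    by blast+
  thus "cubic_comb g (R p 2) x = Y x * (16 * cubic_comb g (R p 2) x + 16 * cubic_comb g (R (Suc p) 1) x +
      16 * cubic_comb g (R p 1) x + 8 * cubic_comb g (R (Suc p) 0) x + 4 * cubic_comb g (R p 0) x)"
    unfolding cubic_comb_def by algebra
qed

section \<open>The two curves\<close>

text \<open>A zero of \<open>1 + c x\<close> forces \<open>|c| |x| = 1\<close>, whereas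
  \<open>|c| |x| \<le> 8/64\<close> in this disc.\<close>

lemma linear_factors_nonzero:
  assumes "norm x < 1 / 64"
  shows "1 - 4 * x \<noteq> (0 :: complex)" "1 + 4 * x \<noteq> 0" "1 - 8 * x \<noteq> 0" "1 + 8 * x \<noteq> 0"
proof -
  have "1 + of_real c * x \<noteq> 0" if "\<bar>c\<bar> \<le> 8" for c :: real
  proof
    assume "1 + of_real c * x = 0"
    hence "of_real c * x = - 1"
      by (simp add: eq_neg_iff_add_eq_0 add.commute)
    hence "\<bar>c\<bar> * norm x = 1"
      by (metis norm_minus_cancel norm_mult norm_of_real norm_one)
    moreover have "\<bar>c\<bar> * norm x \<le> 8 * (1 / 64)"
      using that assms by (intro mult_mono) auto
    ultimately show False by simp
  qed
  from this[of "-4"] this[of 4] this[of "-8"] this[of 8]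
  show "1 - 4 * x \<noteq> 0" "1 + 4 * x \<noteq> 0" "1 - 8 * x \<noteq> 0" "1 + 8 * x \<noteq> 0" by simp_all
qed

text \<open>
  The entry at \<open>p, q, i\<close> of the tables \<open>coeff1\<close> and \<open>coeff2\<close> is the coefficient of \<open>cubic_series i\<close> in the
  Appell series weighted by \<open>k\<^sup>p j\<^sup>q\<close>, divided by \<open>1 + 4x\<close> resp. \<open>\<surd>(1 - 8x)\<close>.  The claimed identities fix the
  series for \<open>1\<close> and \<open>k + j\<close>; the differential equations then force all remaining entries.
\<close>

definition coeff1 :: "nat \<Rightarrow> nat \<Rightarrow> nat \<Rightarrow> complex \<Rightarrow> complex" where
  "coeff1 p q i x =
      [[[1, 0, 0],
        [4 * x / (1 - 4 * x), (1 + 8 * x) / (1 - 4 * x), 0],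
        [4 * x * (1 + 12 * x - 32 * x ^ 2) / (1 - 4 * x) ^ 3,
          4 * x * (5 + 36 * x - 128 * x ^ 2) / (1 - 4 * x) ^ 3,
          16 * x * (1 + 8 * x) / (1 - 4 * x) ^ 2]],
       [[0, 1 / 2, 0],
        [-8 * x ^ 2 / (1 - 4 * x),
          2 * x * (1 - 16 * x) / (1 - 4 * x),
          (1 + 8 * x)],
        [-32 * x ^ 3 * (3 - 44 * x + 96 * x ^ 2) / ((1 - 4 * x) ^ 3 * (1 - 8 * x)),
          2 * x * (1 + 4 * x - 256 * x ^ 2 + 2816 * x ^ 3 - 6144 * x ^ 4) / ((1 - 4 * x) ^ 3 * (1 - 8 * x)),
          16 * x * (1 + 8 * x) * (1 - 8 * x + 24 * x ^ 2) / ((1 - 4 * x) ^ 2 * (1 - 8 * x))]],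
       [[4 * x ^ 2, 16 * x ^ 2, 16 * x ^ 2],
        [16 * x ^ 3 * (3 - 16 * x) / ((1 - 4 * x) * (1 - 8 * x)),
          4 * x ^ 2 * (1 + 48 * x - 256 * x ^ 2) / ((1 - 4 * x) * (1 - 8 * x)),
          16 * x ^ 2 * (1 + 16 * x) / (1 - 8 * x)]]] ! p ! q ! i"

text \<open>Stops at \<open>p, q \<le> 1\<close>, because the differential relations never
  differentiate an entry with a weight 2.\<close>

definition coeff1_deriv :: "nat \<Rightarrow> nat \<Rightarrow> nat \<Rightarrow> complex \<Rightarrow> complex" where
  "coeff1_deriv p q i x =
      [[[0, 0, 0],
        [4 / (1 - 4 * x) ^ 2, 12 / (1 - 4 * x) ^ 2, 0]],
       [[0, 0, 0],
        [-16 * x * (1 - 2 * x) / (1 - 4 * x) ^ 2,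
          2 * (1 - 32 * x + 64 * x ^ 2) / (1 - 4 * x) ^ 2,
          8]]] ! p ! q ! i"

text \<open>The functions \<open>\<xi>\<close> and \<open>\<eta>\<close> are \<open>x X' / X\<close>
  and \<open>x Y' / Y\<close> for \<open>X = x t\<close>, \<open>Y = t\<close>,
  \<open>t = x / (1 + 4x)^2\<close>, and \<open>\<gamma>\<close> belongs to the prefactor
  \<open>1 + 4x\<close>. What remains are rational identities, checked after clearing
  denominators.\<close>

lemma coeff1_solution:
  "appell_solution (\<lambda>x. x ^ 2 / (1 + 4 * x) ^ 2) (\<lambda>x. x / (1 + 4 * x) ^ 2)
     (\<lambda>x. 2 / (1 + 4 * x)) (\<lambda>x. (1 - 4 * x) / (1 + 4 * x)) (ball 0 (1 / 64))
     (\<lambda>p q. cubic_comb (\<lambda>x. 1 + 4 * x) (coeff1 p q))"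
proof (rule cubic_comb_solution[where D = coeff1_deriv and g' = "\<lambda>x. 4" and
      \<gamma> = "\<lambda>x. 4 * x / (1 + 4 * x)"])
  show "\<forall>(p, q)\<in>{(0, 0), (0, 1), (0, 2), (1, 0), (1, 1), (1, 2), (2, 0), (2, 1)}.
      \<forall>i\<in>{0, 1, 2}. coeff1 p q i holomorphic_on ball 0 (1 / 64)"
    by (simp add: coeff1_def [abs_def]; intro conjI;
        (intro holomorphic_intros)?; use linear_factors_nonzero in force)
  fix x :: complex assume "x \<in> ball 0 (1 / 64)"
  hence x: "norm x < 1 / 64" by simp
  note nth_simps = One_nat_def nth_Cons_0 nth_Cons_Suc nth_Cons_numeral pred_numeral_simps BitM.simps numeral_One
  note distrib_simps = distrib_left_numeral distrib_right_numeral left_diff_distrib_numeral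
    right_diff_distrib_numeral
  note nz = linear_factors_nonzero[OF x] linear_factors_nonzero[OF x, simplified]
  show "((\<lambda>x. 1 + 4 * x) has_field_derivative 4) (at x)"
    by (auto intro!: derivative_eq_intros)
  show "x * 4 = (4 * x / (1 + 4 * x)) * (1 + 4 * x)"
    using nz by (simp add: field_simps)
  show "\<forall>p\<in>{0, 1}. \<forall>q\<in>{0, 1}. \<forall>i\<in>{0, 1, 2}.
      (coeff1 p q i has_field_derivative coeff1_deriv p q i x) (at x)"
    by (simp only: ball_simps, intro conjI TrueI; simp add: coeff1_def [abs_def] coeff1_deriv_def;
        (auto intro!: derivative_eq_intros simp: nz divide_simps; algebra?))
  show "\<forall>p\<in>{0, 1}. \<forall>q\<in>{0, 1}.
      (1 - 64 * x ^ 2) * ((4 * x / (1 + 4 * x)) * coeff1 p q 0 x + x * coeff1_deriv p q 0 x) + 16 * x ^ 2 * coeff1 p q 2 x =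
      (1 - 64 * x ^ 2) * ((2 / (1 + 4 * x)) * coeff1 (Suc p) q 0 x + ((1 - 4 * x) / (1 + 4 * x)) * coeff1 p (Suc q) 0 x)"
    by (simp only: ball_simps, intro conjI TrueI; simp only: coeff1_def coeff1_deriv_def nth_simps;
        (simp add: nz divide_simps del: distrib_simps)?; algebra?)
  show "\<forall>p\<in>{0, 1}. \<forall>q\<in>{0, 1}.
      (1 - 64 * x ^ 2) * ((4 * x / (1 + 4 * x)) * coeff1 p q 1 x + x * coeff1_deriv p q 1 x + 2 * coeff1 p q 0 x) + 96 * x ^ 2 * coeff1 p q 2 x =
      (1 - 64 * x ^ 2) * ((2 / (1 + 4 * x)) * coeff1 (Suc p) q 1 x + ((1 - 4 * x) / (1 + 4 * x)) * coeff1 p (Suc q) 1 x)"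
    by (simp only: ball_simps, intro conjI TrueI; simp only: coeff1_def coeff1_deriv_def nth_simps;
        (simp add: nz divide_simps del: distrib_simps)?; algebra?)
  show "\<forall>p\<in>{0, 1}. \<forall>q\<in>{0, 1}.
      (1 - 64 * x ^ 2) * ((4 * x / (1 + 4 * x)) * coeff1 p q 2 x + x * coeff1_deriv p q 2 x + 2 * coeff1 p q 1 x) + 192 * x ^ 2 * coeff1 p q 2 x =
      (1 - 64 * x ^ 2) * ((2 / (1 + 4 * x)) * coeff1 (Suc p) q 2 x + ((1 - 4 * x) / (1 + 4 * x)) * coeff1 p (Suc q) 2 x)"
    by (simp only: ball_simps, intro conjI TrueI; simp only: coeff1_def coeff1_deriv_def nth_simps;
        (simp add: nz divide_simps del: distrib_simps)?; algebra?)
  show "\<forall>q\<in>{0, 1}. \<forall>i\<in>{0, 1, 2}. coeff1 2 q i x = (x ^ 2 / (1 + 4 * x) ^ 2) *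
        (16 * coeff1 2 q i x + 16 * coeff1 1 (Suc q) i x + 16 * coeff1 1 q i x + 8 * coeff1 0 (Suc q) i x + 4 * coeff1 0 q i x)"
    by (simp only: ball_simps, intro conjI TrueI; simp only: coeff1_def coeff1_deriv_def nth_simps;
        (simp add: nz divide_simps del: distrib_simps)?; algebra?)
  show "\<forall>p\<in>{0, 1}. \<forall>i\<in>{0, 1, 2}. coeff1 p 2 i x = (x / (1 + 4 * x) ^ 2) *
        (16 * coeff1 p 2 i x + 16 * coeff1 (Suc p) 1 i x + 16 * coeff1 p 1 i x + 8 * coeff1 (Suc p) 0 i x + 4 * coeff1 p 0 i x)"
    by (simp only: ball_simps, intro conjI TrueI; simp only: coeff1_def coeff1_deriv_def nth_simps;
        (simp add: nz divide_simps del: distrib_simps)?; algebra?)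
qed auto

text \<open>The real part of \<open>1 - 8x\<close> exceeds 7/8, which keeps it off the branch cut of
  \<open>csqrt\<close>.\<close>

lemma one_minus_8_notin_nonpos_Reals:
  fixes x :: complex
  assumes "norm x < 1 / 64"
  shows "1 - 8 * x \<notin> \<real>\<^sub>\<le>\<^sub>0"
proof -
  have "Re x < 1 / 64"
    using assms complex_Re_le_cmod[of x] by simp
  thus ?thesis
    by (auto simp: complex_nonpos_Reals_iff)
qed

definition coeff2 :: "nat \<Rightarrow> nat \<Rightarrow> nat \<Rightarrow> complex \<Rightarrow> complex" where
  "coeff2 p q i x =
      [[[1, 0, 0],
        [-4 * x / (1 + 4 * x), (1 - 8 * x) / (1 + 4 * x), 0],
        [-4 * x * (1 - 12 * x - 32 * x ^ 2) / (1 + 4 * x) ^ 3,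
          -4 * x * (5 - 36 * x - 128 * x ^ 2) / (1 + 4 * x) ^ 3,
          -16 * x * (1 - 8 * x) / (1 + 4 * x) ^ 2]],
       [[-8 * x ^ 2 / ((1 - 4 * x) * (1 + 4 * x)),
          1 / 2 * (1 - 8 * x) * (1 + 8 * x) / ((1 - 4 * x) * (1 + 4 * x)),
          0],
        [-8 * x ^ 2 * (1 - 8 * x - 16 * x ^ 2) / ((1 - 4 * x) * (1 + 4 * x) ^ 3),
          -2 * x * (1 + 24 * x - 112 * x ^ 2 - 384 * x ^ 3) / ((1 - 4 * x) * (1 + 4 * x) ^ 3),
          (1 - 8 * x) * (1 + 8 * x) / (1 + 4 * x) ^ 2],
        [64 * x ^ 3 * (3 - 20 * x - 16 * x ^ 2 + 64 * x ^ 3) / ((1 - 4 * x) * (1 + 4 * x) ^ 5),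
          -2 * x * (1 - 8 * x - 512 * x ^ 2 + 2176 * x ^ 3 + 4864 * x ^ 4 - 8192 * x ^ 5) / ((1 - 4 * x) * (1 + 4 * x) ^ 5),
          -16 * x * (1 - 8 * x) * (1 + 8 * x - 8 * x ^ 2) / (1 + 4 * x) ^ 4]],
       [[-4 * x ^ 2 * (1 - 96 * x ^ 2 + 256 * x ^ 4) / ((1 - 4 * x) ^ 3 * (1 + 4 * x) ^ 3),
          -16 * x ^ 2 * (1 - 96 * x ^ 2 + 512 * x ^ 4) / ((1 - 4 * x) ^ 3 * (1 + 4 * x) ^ 3),
          -16 * x ^ 2 * (1 - 8 * x) * (1 + 8 * x) / ((1 - 4 * x) ^ 2 * (1 + 4 * x) ^ 2)],
        [16 * x ^ 3 * (3 + 4 * x - 352 * x ^ 2 + 640 * x ^ 3 + 768 * x ^ 4 - 3072 * x ^ 5) / ((1 - 4 * x) ^ 3 * (1 + 4 * x) ^ 5),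
          -4 * x ^ 2 * (1 - 52 * x - 128 * x ^ 2 + 5760 * x ^ 3 - 7936 * x ^ 4 - 29696 * x ^ 5 + 57344 * x ^ 6) / ((1 - 4 * x) ^ 3 * (1 + 4 * x) ^ 5),
          -16 * x ^ 2 * (1 - 8 * x) * (1 + 8 * x) * (1 - 16 * x + 16 * x ^ 2) / ((1 - 4 * x) ^ 2 * (1 + 4 * x) ^ 4)]]] ! p ! q ! i"

definition coeff2_deriv :: "nat \<Rightarrow> nat \<Rightarrow> nat \<Rightarrow> complex \<Rightarrow> complex" where
  "coeff2_deriv p q i x =
      [[[0, 0, 0],
        [-4 / (1 + 4 * x) ^ 2, -12 / (1 + 4 * x) ^ 2, 0]],
       [[-16 * x / ((1 - 4 * x) ^ 2 * (1 + 4 * x) ^ 2),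
          -48 * x / ((1 - 4 * x) ^ 2 * (1 + 4 * x) ^ 2),
          0],
        [-16 * x * (1 - 16 * x + 16 * x ^ 2) / ((1 - 4 * x) ^ 2 * (1 + 4 * x) ^ 4),
          -2 * (1 + 40 * x - 480 * x ^ 2 + 128 * x ^ 3 + 1280 * x ^ 4) / ((1 - 4 * x) ^ 2 * (1 + 4 * x) ^ 4),
          -8 * (1 + 16 * x) / (1 + 4 * x) ^ 3]]] ! p ! q ! i"

text \<open>As on the first curve, now with \<open>t = -x / (1 - 8x)\<close>. For the square root
  \<open>\<gamma>\<close> is the rational function \<open>-4x / (1 - 8x)\<close>, so the identities
  for the table remain rational.\<close>

lemma coeff2_solution:
  "appell_solution (\<lambda>x. - (x ^ 2) / (1 - 8 * x)) (\<lambda>x. - x / (1 - 8 * x))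
     (\<lambda>x. 2 * (1 - 4 * x) / (1 - 8 * x)) (\<lambda>x. 1 / (1 - 8 * x)) (ball 0 (1 / 64))
     (\<lambda>p q. cubic_comb (\<lambda>x. csqrt (1 - 8 * x)) (coeff2 p q))"
proof (rule cubic_comb_solution[where D = coeff2_deriv and g' = "\<lambda>x. - 4 / csqrt (1 - 8 * x)" and
      \<gamma> = "\<lambda>x. - 4 * x / (1 - 8 * x)"])
  show "\<forall>(p, q)\<in>{(0, 0), (0, 1), (0, 2), (1, 0), (1, 1), (1, 2), (2, 0), (2, 1)}.
      \<forall>i\<in>{0, 1, 2}. coeff2 p q i holomorphic_on ball 0 (1 / 64)"
    by (simp add: coeff2_def [abs_def]; intro conjI;
        (intro holomorphic_intros)?; use linear_factors_nonzero in force)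
  fix x :: complex assume "x \<in> ball 0 (1 / 64)"
  hence x: "norm x < 1 / 64" by simp
  note nth_simps = One_nat_def nth_Cons_0 nth_Cons_Suc nth_Cons_numeral pred_numeral_simps BitM.simps numeral_One
  note distrib_simps = distrib_left_numeral distrib_right_numeral left_diff_distrib_numeral
    right_diff_distrib_numeral
  note nz = linear_factors_nonzero[OF x] linear_factors_nonzero[OF x, simplified]
  show "((\<lambda>x. csqrt (1 - 8 * x)) has_field_derivative (- 4 / csqrt (1 - 8 * x))) (at x)"
    using one_minus_8_notin_nonpos_Reals[OF x] nz
    by (auto intro!: derivative_eq_intros simp: field_simps)
  show "x * (- 4 / csqrt (1 - 8 * x)) = (- 4 * x / (1 - 8 * x)) * csqrt (1 - 8 * x)"
    using nz power2_csqrt[of "1 - 8 * x"] by (simp add: divide_simps power2_eq_square)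
  show "\<forall>p\<in>{0, 1}. \<forall>q\<in>{0, 1}. \<forall>i\<in>{0, 1, 2}.
      (coeff2 p q i has_field_derivative coeff2_deriv p q i x) (at x)"
    by (simp only: ball_simps, intro conjI TrueI; simp add: coeff2_def [abs_def] coeff2_deriv_def;
        (auto intro!: derivative_eq_intros simp: nz divide_simps; algebra?))
  show "\<forall>p\<in>{0, 1}. \<forall>q\<in>{0, 1}.
      (1 - 64 * x ^ 2) * ((- 4 * x / (1 - 8 * x)) * coeff2 p q 0 x + x * coeff2_deriv p q 0 x) + 16 * x ^ 2 * coeff2 p q 2 x =
      (1 - 64 * x ^ 2) * ((2 * (1 - 4 * x) / (1 - 8 * x)) * coeff2 (Suc p) q 0 x + (1 / (1 - 8 * x)) * coeff2 p (Suc q) 0 x)"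
    by (simp only: ball_simps, intro conjI TrueI; simp only: coeff2_def coeff2_deriv_def nth_simps;
        (simp add: nz divide_simps del: distrib_simps)?; algebra?)
  show "\<forall>p\<in>{0, 1}. \<forall>q\<in>{0, 1}.
      (1 - 64 * x ^ 2) * ((- 4 * x / (1 - 8 * x)) * coeff2 p q 1 x + x * coeff2_deriv p q 1 x + 2 * coeff2 p q 0 x) + 96 * x ^ 2 * coeff2 p q 2 x =
      (1 - 64 * x ^ 2) * ((2 * (1 - 4 * x) / (1 - 8 * x)) * coeff2 (Suc p) q 1 x + (1 / (1 - 8 * x)) * coeff2 p (Suc q) 1 x)"
    by (simp only: ball_simps, intro conjI TrueI; simp only: coeff2_def coeff2_deriv_def nth_simps;
        (simp add: nz divide_simps del: distrib_simps)?; algebra?)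
  show "\<forall>p\<in>{0, 1}. \<forall>q\<in>{0, 1}.
      (1 - 64 * x ^ 2) * ((- 4 * x / (1 - 8 * x)) * coeff2 p q 2 x + x * coeff2_deriv p q 2 x + 2 * coeff2 p q 1 x) + 192 * x ^ 2 * coeff2 p q 2 x =
      (1 - 64 * x ^ 2) * ((2 * (1 - 4 * x) / (1 - 8 * x)) * coeff2 (Suc p) q 2 x + (1 / (1 - 8 * x)) * coeff2 p (Suc q) 2 x)"
    by (simp only: ball_simps, intro conjI TrueI; simp only: coeff2_def coeff2_deriv_def nth_simps;
        (simp add: nz divide_simps del: distrib_simps)?; algebra?)
  show "\<forall>q\<in>{0, 1}. \<forall>i\<in>{0, 1, 2}. coeff2 2 q i x = (- (x ^ 2) / (1 - 8 * x)) *
        (16 * coeff2 2 q i x + 16 * coeff2 1 (Suc q) i x + 16 * coeff2 1 q i x + 8 * coeff2 0 (Suc q) i x + 4 * coeff2 0 q i x)"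
    by (simp only: ball_simps, intro conjI TrueI; simp only: coeff2_def coeff2_deriv_def nth_simps;
        (simp add: nz divide_simps del: distrib_simps)?; algebra?)
  show "\<forall>p\<in>{0, 1}. \<forall>i\<in>{0, 1, 2}. coeff2 p 2 i x = (- x / (1 - 8 * x)) *
        (16 * coeff2 p 2 i x + 16 * coeff2 (Suc p) 1 i x + 16 * coeff2 p 1 i x + 8 * coeff2 (Suc p) 0 i x + 4 * coeff2 p 0 i x)"
    by (simp only: ball_simps, intro conjI TrueI; simp only: coeff2_def coeff2_deriv_def nth_simps;
        (simp add: nz divide_simps del: distrib_simps)?; algebra?)
qed auto

section \<open>The identities\<close>

lemma appell_solution_subset:
  "appell_solution X Y \<xi> \<eta> U f \<Longrightarrow> V \<subseteq> U \<Longrightarrow> appell_solution X Y \<xi> \<eta> V f"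
  unfolding appell_solution_def by (blast intro: holomorphic_on_subset)

section \<open>Size of the two curves near the origin\<close>

lemma norm_one_plus_ge_half:
  assumes "norm (z :: complex) \<le> 1 / 2"
  shows "1 / 2 \<le> norm (1 + z)"
  using norm_diff_ineq[of 1 z] assms by simp

text \<open>With \<open>|1 + 4x| \<ge> 1/2\<close>, the radius 1/4096 gives
  \<open>4 / 4096 = 1/1024\<close>, the bound required by
  \<open>norm_appell_term_le\<close>.\<close>

lemma norm_curve1_le:
  fixes x :: complex
  assumes "norm x < 1 / 4096"
  shows "norm (x / (1 + 4 * x) ^ 2) \<le> 1 / 1024"
    and "norm (x ^ 2 / (1 + 4 * x) ^ 2) \<le> 1 / 1024"
proof -
  have "1 / 2 \<le> norm (1 + 4 * x)"
    using assms by (intro norm_one_plus_ge_half) (simp add: norm_mult)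
  hence "(1 / 2) ^ 2 \<le> norm (1 + 4 * x) ^ 2"
    by (intro power_mono) auto
  hence "norm x / norm (1 + 4 * x) ^ 2 \<le> (1 / 4096) / (1 / 2) ^ 2"
    using assms by (intro frac_le) auto
  thus 1: "norm (x / (1 + 4 * x) ^ 2) \<le> 1 / 1024"
    unfolding norm_divide norm_power by (simp add: power2_eq_square)
  have "norm (x ^ 2 / (1 + 4 * x) ^ 2) = norm x * norm (x / (1 + 4 * x) ^ 2)"
    by (simp add: norm_divide norm_mult norm_power power2_eq_square)
  also have "\<dots> \<le> 1 * (1 / 1024)"
    using assms 1 by (intro mult_mono) auto
  finally show "norm (x ^ 2 / (1 + 4 * x) ^ 2) \<le> 1 / 1024" by simp
qed

lemma norm_curve2_le:
  fixes x :: complex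
  assumes "norm x < 1 / 4096"
  shows "norm (- x / (1 - 8 * x)) \<le> 1 / 1024"
    and "norm (- (x ^ 2) / (1 - 8 * x)) \<le> 1 / 1024"
proof -
  have "1 / 2 \<le> norm (1 + (- 8 * x))"
    using assms by (intro norm_one_plus_ge_half) (simp add: norm_mult)
  hence "norm x / norm (1 - 8 * x) \<le> (1 / 4096) / (1 / 2)"
    using assms by (intro frac_le) auto
  also have "\<dots> \<le> 1 / 1024" by simp
  finally show 1: "norm (- x / (1 - 8 * x)) \<le> 1 / 1024"
    unfolding norm_divide norm_minus_cancel .
  have "norm (- (x ^ 2) / (1 - 8 * x)) = norm x * norm (- x / (1 - 8 * x))"
    by (simp add: norm_divide norm_mult norm_power power2_eq_square)
  also have "\<dots> \<le> 1 * (1 / 1024)"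
    using assms 1 by (intro mult_mono) auto
  finally show "norm (- (x ^ 2) / (1 - 8 * x)) \<le> 1 / 1024" by simp
qed

text \<open>Uniqueness is applied to two solutions on the same curve, the Appell series and the
  combination from the table \<open>coeff1\<close>.\<close>

lemma appell_series_curve1:
  assumes "p \<le> 1" "q \<le> 1"
  shows "\<forall>\<^sub>F x in nhds 0. appell_series (\<lambda>x. x ^ 2 / (1 + 4 * x) ^ 2) (\<lambda>x. x / (1 + 4 * x) ^ 2) p q x =
    cubic_comb (\<lambda>x. 1 + 4 * x) (coeff1 p q) x"
proof (rule appell_solution_unique[where U = "ball 0 (1 / 4096)" and
      X = "\<lambda>x. x ^ 2 / (1 + 4 * x) ^ 2" and Y = "\<lambda>x. x / (1 + 4 * x) ^ 2" and
      \<xi> = "\<lambda>x. 2 / (1 + 4 * x)" and \<eta> = "\<lambda>x. (1 - 4 * x) / (1 + 4 * x)"])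
  have nz: "1 + 4 * x \<noteq> 0" if "x \<in> ball 0 (1 / 4096)" for x :: complex
    using linear_factors_nonzero(2)[of x] that by simp
  show "appell_solution (\<lambda>x. x ^ 2 / (1 + 4 * x) ^ 2) (\<lambda>x. x / (1 + 4 * x) ^ 2)
      (\<lambda>x. 2 / (1 + 4 * x)) (\<lambda>x. (1 - 4 * x) / (1 + 4 * x)) (ball 0 (1 / 4096))
      (appell_series (\<lambda>x. x ^ 2 / (1 + 4 * x) ^ 2) (\<lambda>x. x / (1 + 4 * x) ^ 2))"
  proof (rule appell_series_solution[where X' = "\<lambda>x. 2 * x / (1 + 4 * x) ^ 3" and
        Y' = "\<lambda>x. (1 - 4 * x) / (1 + 4 * x) ^ 3"])
    fix x :: complex assume x: "x \<in> ball 0 (1 / 4096)"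
    note nz = nz[OF x]
    show "((\<lambda>x. x ^ 2 / (1 + 4 * x) ^ 2) has_field_derivative 2 * x / (1 + 4 * x) ^ 3) (at x)"
      using nz by (auto intro!: derivative_eq_intros simp: divide_simps) algebra
    show "((\<lambda>x. x / (1 + 4 * x) ^ 2) has_field_derivative (1 - 4 * x) / (1 + 4 * x) ^ 3) (at x)"
      using nz by (auto intro!: derivative_eq_intros simp: divide_simps) algebra
    show "x * (2 * x / (1 + 4 * x) ^ 3) = 2 / (1 + 4 * x) * (x ^ 2 / (1 + 4 * x) ^ 2)"
      by (simp add: power2_eq_square power3_eq_cube mult_ac)
    show "x * ((1 - 4 * x) / (1 + 4 * x) ^ 3) = (1 - 4 * x) / (1 + 4 * x) * (x / (1 + 4 * x) ^ 2)"
      by (simp add: power2_eq_square power3_eq_cube mult_ac)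
    show "norm (x ^ 2 / (1 + 4 * x) ^ 2) \<le> 1 / 1024" "norm (x / (1 + 4 * x) ^ 2) \<le> 1 / 1024"
      using norm_curve1_le[of x] x by auto
  qed simp
  show "appell_solution (\<lambda>x. x ^ 2 / (1 + 4 * x) ^ 2) (\<lambda>x. x / (1 + 4 * x) ^ 2)
      (\<lambda>x. 2 / (1 + 4 * x)) (\<lambda>x. (1 - 4 * x) / (1 + 4 * x)) (ball 0 (1 / 4096))
      (\<lambda>p q. cubic_comb (\<lambda>x. 1 + 4 * x) (coeff1 p q))"
    by (rule appell_solution_subset[OF coeff1_solution]) auto
  show "(\<lambda>x. x ^ 2 / (1 + 4 * x) ^ 2) holomorphic_on ball 0 (1 / 4096)"
    "(\<lambda>x. x / (1 + 4 * x) ^ 2) holomorphic_on ball 0 (1 / 4096)"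
    "(\<lambda>x. 2 / (1 + 4 * x)) holomorphic_on ball 0 (1 / 4096)"
    "(\<lambda>x. (1 - 4 * x) / (1 + 4 * x)) holomorphic_on ball 0 (1 / 4096)"
    using nz by (intro holomorphic_intros; force)+
  \<comment> \<open>At 0 only \<open>cubic_series 0\<close> is nonzero, so the first entry of each
    row decides: it is 1 for \<open>p = q = 0\<close> and 0 otherwise, in agreement with
    \<open>0 ^ p * 0 ^ q\<close>.\<close>
  fix p q :: nat assume "p \<le> 1" "q \<le> 1"
  hence "p \<in> {0, 1}" "q \<in> {0, 1}" by auto
  thus "appell_series (\<lambda>x. x ^ 2 / (1 + 4 * x) ^ 2) (\<lambda>x. x / (1 + 4 * x) ^ 2) p q 0 =
      cubic_comb (\<lambda>x. 1 + 4 * x) (coeff1 p q) 0"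
    by (auto simp: appell_series_0 cubic_comb_def cubic_series_at_0 coeff1_def)
qed (use assms in auto)

lemma appell_series_curve2:
  assumes "p \<le> 1" "q \<le> 1"
  shows "\<forall>\<^sub>F x in nhds 0. appell_series (\<lambda>x. - (x ^ 2) / (1 - 8 * x)) (\<lambda>x. - x / (1 - 8 * x)) p q x =
    cubic_comb (\<lambda>x. csqrt (1 - 8 * x)) (coeff2 p q) x"
proof (rule appell_solution_unique[where U = "ball 0 (1 / 4096)" and
      X = "\<lambda>x. - (x ^ 2) / (1 - 8 * x)" and Y = "\<lambda>x. - x / (1 - 8 * x)" and
      \<xi> = "\<lambda>x. 2 * (1 - 4 * x) / (1 - 8 * x)" and \<eta> = "\<lambda>x. 1 / (1 - 8 * x)"])
  have nz: "1 - 8 * x \<noteq> 0" if "x \<in> ball 0 (1 / 4096)" for x :: complex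
    using linear_factors_nonzero(3)[of x] that by simp
  show "appell_solution (\<lambda>x. - (x ^ 2) / (1 - 8 * x)) (\<lambda>x. - x / (1 - 8 * x))
      (\<lambda>x. 2 * (1 - 4 * x) / (1 - 8 * x)) (\<lambda>x. 1 / (1 - 8 * x)) (ball 0 (1 / 4096))
      (appell_series (\<lambda>x. - (x ^ 2) / (1 - 8 * x)) (\<lambda>x. - x / (1 - 8 * x)))"
  proof (rule appell_series_solution[where X' = "\<lambda>x. - 2 * x * (1 - 4 * x) / (1 - 8 * x) ^ 2" and
        Y' = "\<lambda>x. - 1 / (1 - 8 * x) ^ 2"])
    fix x :: complex assume x: "x \<in> ball 0 (1 / 4096)"
    note nz = nz[OF x]
    show "((\<lambda>x. - (x ^ 2) / (1 - 8 * x)) has_field_derivative - 2 * x * (1 - 4 * x) / (1 - 8 * x) ^ 2) (at x)"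
      using nz by (auto intro!: derivative_eq_intros simp: divide_simps) algebra
    show "((\<lambda>x. - x / (1 - 8 * x)) has_field_derivative - 1 / (1 - 8 * x) ^ 2) (at x)"
      using nz by (auto intro!: derivative_eq_intros simp: divide_simps) algebra
    show "x * (- 2 * x * (1 - 4 * x) / (1 - 8 * x) ^ 2) =
        2 * (1 - 4 * x) / (1 - 8 * x) * (- (x ^ 2) / (1 - 8 * x))"
      by (simp add: power2_eq_square)
    show "x * (- 1 / (1 - 8 * x) ^ 2) = 1 / (1 - 8 * x) * (- x / (1 - 8 * x))"
      by (simp add: power2_eq_square)
    show "norm (- (x ^ 2) / (1 - 8 * x)) \<le> 1 / 1024" "norm (- x / (1 - 8 * x)) \<le> 1 / 1024"
      using norm_curve2_le[of x] x by auto
  qed simp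
  show "appell_solution (\<lambda>x. - (x ^ 2) / (1 - 8 * x)) (\<lambda>x. - x / (1 - 8 * x))
      (\<lambda>x. 2 * (1 - 4 * x) / (1 - 8 * x)) (\<lambda>x. 1 / (1 - 8 * x)) (ball 0 (1 / 4096))
      (\<lambda>p q. cubic_comb (\<lambda>x. csqrt (1 - 8 * x)) (coeff2 p q))"
    by (rule appell_solution_subset[OF coeff2_solution]) auto
  show "(\<lambda>x. - (x ^ 2) / (1 - 8 * x)) holomorphic_on ball 0 (1 / 4096)"
    "(\<lambda>x. - x / (1 - 8 * x)) holomorphic_on ball 0 (1 / 4096)"
    "(\<lambda>x. 2 * (1 - 4 * x) / (1 - 8 * x)) holomorphic_on ball 0 (1 / 4096)"
    "(\<lambda>x. 1 / (1 - 8 * x)) holomorphic_on ball 0 (1 / 4096)"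
    using nz by (intro holomorphic_intros; force)+
  fix p q :: nat assume "p \<le> 1" "q \<le> 1"
  hence "p \<in> {0, 1}" "q \<in> {0, 1}" by auto
  thus "appell_series (\<lambda>x. - (x ^ 2) / (1 - 8 * x)) (\<lambda>x. - x / (1 - 8 * x)) p q 0 =
      cubic_comb (\<lambda>x. csqrt (1 - 8 * x)) (coeff2 p q) 0"
    by (auto simp: appell_series_0 cubic_comb_def cubic_series_at_0 coeff2_def)
qed (use assms in auto)

text \<open>Splitting \<open>w^n = w^k w^(n-k)\<close> and \<open>n = k + (n-k)\<close> identifies
  the left-hand terms of the theorem with Appell terms at \<open>X = x w\<close>,
  \<open>Y = w\<close>.\<close>

lemma appell_term_linear_weight:
  "of_nat (2 * n choose n) * (a * of_nat n + b) * w ^ n *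
     (\<Sum>k=0..n. of_nat (n choose k) * of_nat (2 * k choose k) * of_nat (2 * n - 2 * k choose (n - k)) * x ^ k) =
   a * (appell_term 1 0 n (x * w) w + appell_term 0 1 n (x * w) w) + b * appell_term 0 0 n (x * w) w"
proof -
  have "of_nat (2 * n choose n) * (a * of_nat n + b) * w ^ n *
      (\<Sum>k=0..n. of_nat (n choose k) * of_nat (2 * k choose k) * of_nat (2 * n - 2 * k choose (n - k)) * x ^ k) =
    (\<Sum>k=0..n. of_nat (2 * n choose n) * ((a * (of_nat k + of_nat (n - k)) + b) * (of_nat (n choose k) *
      of_nat (2 * k choose k) * of_nat (2 * (n - k) choose (n - k)) * (x * w) ^ k * w ^ (n - k))))"
    unfolding sum_distrib_left
  proof (rule sum.cong)
    fix k assume "k \<in> {0..n}"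
    hence k: "k \<le> n" by simp
    have "w ^ n = w ^ k * w ^ (n - k)" "of_nat n = of_nat k + (of_nat (n - k) :: complex)"
      using k by (simp_all flip: power_add of_nat_add)
    thus "of_nat (2 * n choose n) * (a * of_nat n + b) * w ^ n *
        (of_nat (n choose k) * of_nat (2 * k choose k) * of_nat (2 * n - 2 * k choose (n - k)) * x ^ k) =
      of_nat (2 * n choose n) * ((a * (of_nat k + of_nat (n - k)) + b) * (of_nat (n choose k) *
        of_nat (2 * k choose k) * of_nat (2 * (n - k) choose (n - k)) * (x * w) ^ k * w ^ (n - k)))"
      unfolding diff_mult_distrib2[symmetric] by (simp only: power_mult_distrib mult_ac)
  qed simp
  also have "\<dots> = a * (appell_term 1 0 n (x * w) w + appell_term 0 1 n (x * w) w) + b * appell_term 0 0 n (x * w) w"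
    unfolding appell_term_def sum_distrib_left sum.distrib[symmetric]
    by (intro sum.cong refl) (simp only: power_one_right power_0 mult_1_left mult_1_right distrib_left distrib_right mult_ac)
  finally show ?thesis .
qed

text \<open>Serves both halves of the theorem: each reduces to the relation \<open>eq\<close>
  between sums, and convergence comes from the geometric bounds.\<close>

lemma series_identity:
  fixes x w a b A B :: complex
  assumes x: "norm x < 1 / 64" and w: "norm (x * w) \<le> 1 / 1024" "norm w \<le> 1 / 1024"
    and eq: "a * ((\<Sum>n. appell_term 1 0 n (x * w) w) + (\<Sum>n. appell_term 0 1 n (x * w) w)) +
        b * (\<Sum>n. appell_term 0 0 n (x * w) w) = A * cubic_series 1 x + B * cubic_series 0 x"
  defines "L \<equiv> \<lambda>n. of_nat (2 * n choose n) * (a * of_nat n + b) * w ^ n *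
     (\<Sum>k=0..n. of_nat (n choose k) * of_nat (2 * k choose k) * of_nat (2 * n - 2 * k choose (n - k)) * x ^ k)"
    and "R \<equiv> \<lambda>n. of_nat (2 * n choose n) ^ 3 * (A * of_nat n + B) * x ^ (2 * n)"
  shows "summable L \<and> summable R \<and> suminf L = suminf R"
proof -
  have "R = (\<lambda>n. A * (of_nat n ^ 1 * of_nat (2 * n choose n) ^ 3 * x ^ (2 * n)) +
      B * (of_nat n ^ 0 * of_nat (2 * n choose n) ^ 3 * x ^ (2 * n)))"
    by (simp add: R_def fun_eq_iff algebra_simps)
  also have "\<dots> sums (A * cubic_series 1 x + B * cubic_series 0 x)"
    using x by (intro sums_add sums_mult cubic_series_sums) auto
  finally have R: "R sums (A * cubic_series 1 x + B * cubic_series 0 x)" .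
  have "L = (\<lambda>n. a * (appell_term 1 0 n (x * w) w + appell_term 0 1 n (x * w) w) +
      b * appell_term 0 0 n (x * w) w)"
    unfolding L_def by (intro ext appell_term_linear_weight)
  also have "\<dots> sums (a * ((\<Sum>n. appell_term 1 0 n (x * w) w) + (\<Sum>n. appell_term 0 1 n (x * w) w)) +
        b * (\<Sum>n. appell_term 0 0 n (x * w) w))"
    using w by (intro sums_add sums_mult summable_sums summable_appell_term) auto
  finally show ?thesis
    using R unfolding eq by (auto simp: sums_iff)
qed

theorem theorem4p2:
  fixes a b c d :: complex
  shows "\<forall>\<^sub>F x in nhds (0::complex).
    (let A = 3 * a / 2 * ((1 + 4 * x)^2 / (1 - 4 * x));
         B = (1 + 4 * x) * (b + 4 * a * x / (1 - 4 * x));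
         C = 3 * c / 2 * ((1 - 8 * x) powr (3 / 2) / (1 - 16 * x^2));
         D = csqrt (1 - 8 * x) * (d - 4 * c * x * (1 - 2 * x) / (1 - 16 * x^2));
         p = (\<lambda>n. \<Sum>k=0..n. of_nat (n choose k) * of_nat ((2 * k) choose k)
                 * of_nat ((2 * n - 2 * k) choose (n - k)) * x^k);
         L1 = (\<lambda>n. of_nat ((2 * n) choose n) * (a * of_nat n + b)
                 * (x^n / (1 + 4 * x)^(2 * n)) * p n);
         R1 = (\<lambda>n. of_nat ((2 * n) choose n)^3 * (A * of_nat n + B) * x^(2 * n));
         L2 = (\<lambda>n. of_nat ((2 * n) choose n) * (c * of_nat n + d)
                 * ((- x)^n / (1 - 8 * x)^n) * p n);
         R2 = (\<lambda>n. of_nat ((2 * n) choose n)^3 * (C * of_nat n + D) * x^(2 * n))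
     in (summable L1 \<and> summable R1 \<and> (\<Sum>n. L1 n) = (\<Sum>n. R1 n)) \<and>
        (summable L2 \<and> summable R2 \<and> (\<Sum>n. L2 n) = (\<Sum>n. R2 n)))"
proof -
  have "\<forall>\<^sub>F x :: complex in nhds 0. x \<in> ball 0 (1 / 4096)"
    by (intro eventually_nhds_in_open) auto
  moreover have "\<forall>\<^sub>F x in nhds 0. \<forall>(p, q)\<in>{(0, 0), (1, 0), (0, 1)}.
      appell_series (\<lambda>x. x ^ 2 / (1 + 4 * x) ^ 2) (\<lambda>x. x / (1 + 4 * x) ^ 2) p q x =
        cubic_comb (\<lambda>x. 1 + 4 * x) (coeff1 p q) x"
    using appell_series_curve1[of 0 0] appell_series_curve1[of 1 0] appell_series_curve1[of 0 1]
    by (simp add: eventually_conj_iff)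
  moreover have "\<forall>\<^sub>F x in nhds 0. \<forall>(p, q)\<in>{(0, 0), (1, 0), (0, 1)}.
      appell_series (\<lambda>x. - (x ^ 2) / (1 - 8 * x)) (\<lambda>x. - x / (1 - 8 * x)) p q x =
        cubic_comb (\<lambda>x. csqrt (1 - 8 * x)) (coeff2 p q) x"
    using appell_series_curve2[of 0 0] appell_series_curve2[of 1 0] appell_series_curve2[of 0 1]
    by (simp add: eventually_conj_iff)
  ultimately show ?thesis
  proof eventually_elim
    case (elim x)
    hence x: "norm x < 1 / 4096" by simp
    hence x': "norm x < 1 / 64" by simp
    note nz = linear_factors_nonzero[OF x'] linear_factors_nonzero[OF x', simplified]
    have X1: "x ^ 2 / (1 + 4 * x) ^ 2 = x * (x / (1 + 4 * x) ^ 2)"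
      by (simp add: power2_eq_square)
    have X2: "- (x ^ 2) / (1 - 8 * x) = x * (- x / (1 - 8 * x))"
      by (simp add: power2_eq_square)
    have factor: "1 - 16 * x ^ 2 = (1 - 4 * x) * (1 + 4 * x)"
      by algebra
    \<comment> \<open>Splitting \<open>3/2 = 1/2 + 1\<close> isolates the principal root, which is
      the prefactor on the second curve.\<close>
    have powr: "(1 - 8 * x) powr (3 / 2) = csqrt (1 - 8 * x) * (1 - 8 * x)"
    proof -
      have "(1 - 8 * x) powr (3 / 2) = (1 - 8 * x) powr (1 / 2 + 1)"
        by simp
      also have "\<dots> = (1 - 8 * x) powr (1 / 2) * (1 - 8 * x) powr 1"
        by (rule powr_add)
      finally show ?thesis
        using nz by (simp add: csqrt_conv_powr)
    qed
    define w1 where "w1 = x / (1 + 4 * x) ^ 2"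
    define w2 where "w2 = - x / (1 - 8 * x)"
    have sum1: "(\<Sum>n. appell_term p q n (x * w1) w1) = cubic_comb (\<lambda>x. 1 + 4 * x) (coeff1 p q) x"
      if "(p, q) \<in> {(0, 0), (1, 0), (0, 1)}" for p q
      using elim(2) that unfolding appell_series_def X1 w1_def by blast
    have sum2: "(\<Sum>n. appell_term p q n (x * w2) w2) = cubic_comb (\<lambda>x. csqrt (1 - 8 * x)) (coeff2 p q) x"
      if "(p, q) \<in> {(0, 0), (1, 0), (0, 1)}" for p q
      using elim(3) that unfolding appell_series_def X2 w2_def by blast
    have pow: "x ^ n / (1 + 4 * x) ^ (2 * n) = w1 ^ n" "(- x) ^ n / (1 - 8 * x) ^ n = w2 ^ n" for n
      by (simp_all only: w1_def w2_def power_divide power_mult)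
    show ?case
      unfolding Let_def pow
    proof (intro conjI[OF series_identity series_identity])
      show "norm (x * w1) \<le> 1 / 1024" "norm w1 \<le> 1 / 1024"
        unfolding w1_def X1[symmetric] using norm_curve1_le[OF x] by simp_all
      show "norm (x * w2) \<le> 1 / 1024" "norm w2 \<le> 1 / 1024"
        unfolding w2_def X2[symmetric] using norm_curve2_le[OF x] by simp_all
      \<comment> \<open>The rows \<open>(1,0)\<close> and \<open>(0,1)\<close> have no
        \<open>cubic_series 2\<close> part. They add up to \<open>4x / (1 - 4x)\<close> and
        \<open>3 (1 + 4x) / (2 (1 - 4x))\<close>, which after multiplication by
        \<open>1 + 4x\<close> are the contributions of \<open>a\<close> to \<open>B\<close> and
        \<open>A\<close>.\<close>
      show "a * ((\<Sum>n. appell_term 1 0 n (x * w1) w1) + (\<Sum>n. appell_term 0 1 n (x * w1) w1)) +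
          b * (\<Sum>n. appell_term 0 0 n (x * w1) w1) =
        3 * a / 2 * ((1 + 4 * x) ^ 2 / (1 - 4 * x)) * cubic_series 1 x +
          (1 + 4 * x) * (b + 4 * a * x / (1 - 4 * x)) * cubic_series 0 x"
        by (simp only: sum1 insert_iff simp_thms) (simp add: cubic_comb_def coeff1_def nz divide_simps; algebra)
      \<comment> \<open>Here the two rows add up to \<open>-4x (1 - 2x) / (1 - 16x^2)\<close> and
        \<open>3 (1 - 8x) / (2 (1 - 16x^2))\<close>; the factor \<open>1 - 8x\<close> turns the root
        into the power 3/2 in \<open>C\<close>.\<close>
      show "c * ((\<Sum>n. appell_term 1 0 n (x * w2) w2) + (\<Sum>n. appell_term 0 1 n (x * w2) w2)) +
          d * (\<Sum>n. appell_term 0 0 n (x * w2) w2) =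
        3 * c / 2 * ((1 - 8 * x) powr (3 / 2) / (1 - 16 * x ^ 2)) * cubic_series 1 x +
          csqrt (1 - 8 * x) * (d - 4 * c * x * (1 - 2 * x) / (1 - 16 * x ^ 2)) * cubic_series 0 x"
        by (simp only: sum2 insert_iff simp_thms powr factor)
          (simp add: cubic_comb_def coeff2_def nz divide_simps; algebra)
    qed (use x' in auto)
  qed
qed

end
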